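(* There exist absolute constants $c_1>0$, $c_0,c_2\ge1$, $\tilde C_1\ge15$, and $\tilde C_3,\tilde C_4,\tilde C_5,\tilde C_6\ge 1$ such that the following holds. Suppose $G_{t'}\sim\mathcal G(n,p(t'))$ for all $t'\in\mathcal T$, let $t\in[0,1]$, choose $d_\delta(t)=3np_\delta(t)$, and let $\delta\in[\tfrac12,T]$ be such that $n\ge c_1\log n$, $np_\delta(t)\ge c_0\log n$, $p_{\delta,sum}(t)\ge c_2\log n$ and $$2\tilde C_1\sqrt{\frac{\log n}{L\,n\,p_\delta(t)\,p_{\delta,sum}(t)}}+16\,\frac{M\delta n}{T}\le\frac{1}{96\,b^{7/2}(t)}.$$ If additionally $$96\,b^{5/2}(t)\left(\frac{4M\delta}{T}+\tilde C_3\sqrt{\frac{\log n}{np_\delta(t)}}\right)\le\frac12,$$ then with probability at least $1-O(n^{-9})$, $$\frac{\|\hat\pi(t)-\pi^*(t)\|_\infty}{\|\pi^*(t)\|_\infty}\le\frac{12\,b_{\max,\delta}(t)}{1-\tilde C_4\,b_{\max,\delta}(t)\sqrt{\frac{\log n}{np_\delta(t)}}}\left(\tilde C_5\,\gamma_{n,\delta}(t)\sqrt{\frac{\log n}{L\,n\,p_\delta(t)\,p_{\delta,sum}(t)}}+\tilde C_6\,\frac{Mn\delta\,b^{7/2}(t)}{T}\right),$$ where $\gamma_{n,\delta}(t)=1+\frac{b^{5/2}(t)}{\sqrt{\log n}}\max\left\{b^2(t),\frac{\log n}{\sqrt{np_\delta(t)}}\right\}$ and $b_{\max,\delta}(t)=\max_{t'\in\mathcal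 N_\delta(t)}b(t')$.
   Context: Dynamic BTL model. Let $n\ge 2$, $T\ge 1$, $L\ge 1$ be integers, $[n]=\{1,\dots,n\}$. For each $t\in[0,1]$ let $w_t^*\in\mathbb R^n$ have strictly positive entries $w^*_{t,i}$, and for $i\ne j$ put $y^*_{ij}(t)=\frac{w^*_{t,j}}{w^*_{t,i}+w^*_{t,j}}$. Smoothness assumption: there is $M\ge0$ with $|y^*_{ij}(t)-y^*_{ij}(t')|\le M|t-t'|$ for all $t,t'\in[0,1]$ and $i\ne j$. Grid: $\mathcal T=\{i/T: i=0,\dots,T\}$. For each $t'\in\mathcal T$ there is an undirected comparison graph $G_{t'}=([n],\mathcal E_{t'})$. Given the graphs, for each $t'\in\mathcal T$, $\{i,j\}\in\mathcal E_{t'}$ and $l\in\{1,\dots,L\}$ one observes $y^{(l)}_{ij}(t')\in\{0,1\}$ with $\mathbb P(y^{(l)}_{ij}(t')=1)=y^*_{ij}(t')$ (the value 1 means $j$ beats $i$), with $y^{(l)}_{ji}(t')=1-y^{(l)}_{ij}(t')$, all outcomes being independent across unordered pairs, times $t'$ and indices $l$. Put $y_{ij}(t')=\frac1L\sum_{l=1}^L y^{(l)}_{ij}(t')$. Neighborhood and union graph. For $t\in[0,1]$, $\delta\in[\frac12,T]$: $\mathcal N_\delta(t)=\{t'\in\mathcal T: |t-t'|\le \delta/T\}$; $\mathcal N_{ij,\delta}(t)=\{t'\in\mathcal N_\delta(t): \{i,j\}\in\mathcal E_{t'}\}$; $\mathcal E_\delta(t)=\bigcup_{t'\in\mathcal N_\delta(t)}\mathcal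 E_{t'}$. Erdős–Rényi setting. $\mathcal G(n,p)$ is the Erdős–Rényi random graph; the graphs $G_{t'}\sim\mathcal G(n,p(t'))$, $t'\in\mathcal T$, are mutually independent. Put $p_\delta(t)=1-\prod_{t'\in\mathcal N_\delta(t)}(1-p(t'))$ and $p_{\delta,sum}(t)=\sum_{t'\in\mathcal N_\delta(t)}p(t')$. Estimator. With normalization $d_\delta(t)$, define $\hat P(t)\in\mathbb R^{n\times n}$ by $\hat P_{ij}(t)=\frac{1}{d_\delta(t)|\mathcal N_{ij,\delta}(t)|}\sum_{t'\in\mathcal N_{ij,\delta}(t)}y_{ij}(t')$ if $\{i,j\}\in\mathcal E_\delta(t)$, $\hat P_{ij}(t)=0$ for other $i\neq j$, and $\hat P_{ii}(t)=1-\sum_{k\ne i}\hat P_{ik}(t)$. $\hat\pi(t)$ is the stationary distribution (leading left eigenvector, normalized to be a probability vector) of $\hat P(t)$. The target is $\pi^*(t)=w_t^*/\sum_{i=1}^n w^*_{t,i}$, and $b(t)=\max_{i,j\in[n]}w^*_{t,i}/w^*_{t,j}$. Convention: $O(\cdot)$ hides an absolute constant. Probability is over both graphs and outcomes. *)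

theory Defs
  imports "HOL-Probability.Probability" "HOL-Probability.Product_PMF"
begin

text \<open>
  Vectors indexed by $[n]$ are functions on \<open>nat\<close> read on \<open>{1..n}\<close>, and \<open>n \<times> n\<close> matrices
  are binary such functions: the constants of the theorem do not depend on \<open>n\<close>, so \<open>n\<close> cannot be
  the cardinality of an index type.  A score curve \<open>w\<close> has entries \<open>w t i\<close>; grid times are the
  real numbers \<open>i / T\<close>.
\<close>

type_synonym matrix = "nat \<Rightarrow> nat \<Rightarrow> real"
type_synonym graphs = "real \<Rightarrow> nat set set"
type_synonym outcomes = "real \<times> nat \<times> nat \<times> nat \<Rightarrow> bool"


definition grid :: "nat \<Rightarrow> real set" where
  "grid T = (\<lambda>i. real i / real T) ` {0..T}"

definition nbhd :: "nat \<Rightarrow> real \<Rightarrow> real \<Rightarrow> real set" where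
  "nbhd T \<delta> t = {s \<in> grid T. \<bar>t - s\<bar> \<le> \<delta> / real T}"

definition pairs :: "nat \<Rightarrow> nat set set" where
  "pairs n = {e. e \<subseteq> {1..n} \<and> card e = 2}"


text \<open>\<open>y_star w t i j\<close> is the probability that \<open>j\<close> beats \<open>i\<close>.\<close>

definition y_star :: "(real \<Rightarrow> nat \<Rightarrow> real) \<Rightarrow> real \<Rightarrow> matrix" where
  "y_star w t i j = w t j / (w t i + w t j)"

definition positive_scores :: "nat \<Rightarrow> (real \<Rightarrow> nat \<Rightarrow> real) \<Rightarrow> bool" where
  "positive_scores n w \<longleftrightarrow> (\<forall>t\<in>{0..1}. \<forall>i\<in>{1..n}. 0 < w t i)"

definition smooth_scores :: "nat \<Rightarrow> (real \<Rightarrow> nat \<Rightarrow> real) \<Rightarrow> real \<Rightarrow> bool" where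
  "smooth_scores n w M \<longleftrightarrow> 0 \<le> M \<and>
     (\<forall>t\<in>{0..1}. \<forall>t'\<in>{0..1}. \<forall>i\<in>{1..n}. \<forall>j\<in>{1..n}. i \<noteq> j \<longrightarrow>
        \<bar>y_star w t i j - y_star w t' i j\<bar> \<le> M * \<bar>t - t'\<bar>)"

definition pi_star :: "nat \<Rightarrow> (real \<Rightarrow> nat \<Rightarrow> real) \<Rightarrow> real \<Rightarrow> nat \<Rightarrow> real" where
  "pi_star n w t i = w t i / (\<Sum>k\<in>{1..n}. w t k)"

definition b_ratio :: "nat \<Rightarrow> (real \<Rightarrow> nat \<Rightarrow> real) \<Rightarrow> real \<Rightarrow> real" where
  "b_ratio n w t = Max ((\<lambda>(i, j). w t i / w t j) ` ({1..n} \<times> {1..n}))"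

definition b_max :: "nat \<Rightarrow> nat \<Rightarrow> (real \<Rightarrow> nat \<Rightarrow> real) \<Rightarrow> real \<Rightarrow> real \<Rightarrow> real" where
  "b_max n T w \<delta> t = Max (b_ratio n w ` nbhd T \<delta> t)"


definition erdos_renyi :: "nat \<Rightarrow> real \<Rightarrow> nat set set pmf" where
  "erdos_renyi n q =
     map_pmf (\<lambda>present. {e \<in> pairs n. present e}) (Pi_pmf (pairs n) False (\<lambda>_. bernoulli_pmf q))"

definition random_graphs :: "nat \<Rightarrow> nat \<Rightarrow> (real \<Rightarrow> real) \<Rightarrow> graphs pmf" where
  "random_graphs n T p = Pi_pmf (grid T) {} (\<lambda>s. erdos_renyi n (p s))"

text \<open>
  Conditionally on the graphs there is one independent Bernoulli variable per grid time, edge and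
  repetition.  An edge is represented by its increasing orientation, so that the unordered pair
  carries a single variable; \<open>y_obs\<close> recovers the other orientation through
  $y_{ji}^{(l)} = 1 - y_{ij}^{(l)}$.
\<close>

definition comparisons :: "nat \<Rightarrow> nat \<Rightarrow> nat \<Rightarrow> graphs \<Rightarrow> (real \<times> nat \<times> nat \<times> nat) set" where
  "comparisons n T L E =
     {(s, i, j, l). s \<in> grid T \<and> i \<in> {1..n} \<and> j \<in> {1..n} \<and> i < j \<and> {i, j} \<in> E s \<and> l \<in> {1..L}}"

definition random_outcomes ::
    "nat \<Rightarrow> nat \<Rightarrow> nat \<Rightarrow> (real \<Rightarrow> nat \<Rightarrow> real) \<Rightarrow> graphs \<Rightarrow> outcomes pmf" where
  "random_outcomes n T L w E =
     Pi_pmf (comparisons n T L E) False (\<lambda>(s, i, j, l). bernoulli_pmf (y_star w s i j))"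

definition dynamic_btl ::
    "nat \<Rightarrow> nat \<Rightarrow> nat \<Rightarrow> (real \<Rightarrow> nat \<Rightarrow> real) \<Rightarrow> (real \<Rightarrow> real) \<Rightarrow> (graphs \<times> outcomes) pmf" where
  "dynamic_btl n T L w p =
     bind_pmf (random_graphs n T p) (\<lambda>E. map_pmf (Pair E) (random_outcomes n T L w E))"

definition y_obs :: "outcomes \<Rightarrow> nat \<Rightarrow> real \<Rightarrow> matrix" where
  "y_obs Y l s i j = (if i < j then of_bool (Y (s, i, j, l)) else 1 - of_bool (Y (s, j, i, l)))"

definition y_mean :: "nat \<Rightarrow> outcomes \<Rightarrow> real \<Rightarrow> matrix" where
  "y_mean L Y s i j = 1 / real L * (\<Sum>l\<in>{1..L}. y_obs Y l s i j)"


definition p_union :: "nat \<Rightarrow> (real \<Rightarrow> real) \<Rightarrow> real \<Rightarrow> real \<Rightarrow> real" where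
  "p_union T p \<delta> t = 1 - (\<Prod>s\<in>nbhd T \<delta> t. 1 - p s)"

definition p_sum :: "nat \<Rightarrow> (real \<Rightarrow> real) \<Rightarrow> real \<Rightarrow> real \<Rightarrow> real" where
  "p_sum T p \<delta> t = (\<Sum>s\<in>nbhd T \<delta> t. p s)"

definition nbhd_edge :: "nat \<Rightarrow> graphs \<Rightarrow> real \<Rightarrow> real \<Rightarrow> nat \<Rightarrow> nat \<Rightarrow> real set" where
  "nbhd_edge T E \<delta> t i j = {s \<in> nbhd T \<delta> t. {i, j} \<in> E s}"

definition union_edges :: "nat \<Rightarrow> graphs \<Rightarrow> real \<Rightarrow> real \<Rightarrow> nat set set" where
  "union_edges T E \<delta> t = (\<Union>s\<in>nbhd T \<delta> t. E s)"

definition P_hat_off ::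
    "nat \<Rightarrow> nat \<Rightarrow> real \<Rightarrow> real \<Rightarrow> real \<Rightarrow> graphs \<Rightarrow> outcomes \<Rightarrow> matrix" where
  "P_hat_off T L d \<delta> t E Y i j =
     (if {i, j} \<in> union_edges T E \<delta> t
      then 1 / (d * real (card (nbhd_edge T E \<delta> t i j)))
             * (\<Sum>s\<in>nbhd_edge T E \<delta> t i j. y_mean L Y s i j)
      else 0)"

definition P_hat ::
    "nat \<Rightarrow> nat \<Rightarrow> nat \<Rightarrow> real \<Rightarrow> real \<Rightarrow> real \<Rightarrow> graphs \<Rightarrow> outcomes \<Rightarrow> matrix" where
  "P_hat n T L d \<delta> t E Y i j =
     (if i \<noteq> j then P_hat_off T L d \<delta> t E Y i j
      else 1 - (\<Sum>k\<in>{1..n} - {i}. P_hat_off T L d \<delta> t E Y i k))"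


definition transition_matrix :: "nat \<Rightarrow> matrix \<Rightarrow> bool" where
  "transition_matrix n P \<longleftrightarrow>
     (\<forall>i\<in>{1..n}. \<forall>j\<in>{1..n}. 0 \<le> P i j) \<and> (\<forall>i\<in>{1..n}. (\<Sum>j\<in>{1..n}. P i j) = 1)"

text \<open>Entries outside \<open>{1..n}\<close> are set to 0 so that uniqueness can be stated with \<open>\<exists>!\<close>.\<close>

definition prob_vector :: "nat \<Rightarrow> (nat \<Rightarrow> real) \<Rightarrow> bool" where
  "prob_vector n x \<longleftrightarrow>
     (\<forall>i\<in>{1..n}. 0 \<le> x i) \<and> (\<Sum>i\<in>{1..n}. x i) = 1 \<and> (\<forall>i. i \<notin> {1..n} \<longrightarrow> x i = 0)"

text \<open>
  The rows of \<open>P_hat\<close> always sum to 1, but a diagonal entry is negative when \<open>d\<close> is too small for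
  the realised graph, so being a transition matrix is part of the notion.  For a transition matrix
  the eigenvalue 1 has maximal modulus, hence a stationary distribution is a leading left
  eigenvector.
\<close>

definition stationary_distribution :: "nat \<Rightarrow> matrix \<Rightarrow> (nat \<Rightarrow> real) \<Rightarrow> bool" where
  "stationary_distribution n P x \<longleftrightarrow> transition_matrix n P \<and> prob_vector n x \<and>
     (\<forall>j\<in>{1..n}. (\<Sum>i\<in>{1..n}. x i * P i j) = x j)"

text \<open>\<open>pi_hat\<close> is meaningful only where the stationary distribution exists and is unique.\<close>

definition pi_hat_defined ::
    "nat \<Rightarrow> nat \<Rightarrow> nat \<Rightarrow> real \<Rightarrow> real \<Rightarrow> real \<Rightarrow> graphs \<Rightarrow> outcomes \<Rightarrow> bool" where
  "pi_hat_defined n T L d \<delta> t E Y \<longleftrightarrow>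
     (\<exists>!x. stationary_distribution n (P_hat n T L d \<delta> t E Y) x)"

definition pi_hat ::
    "nat \<Rightarrow> nat \<Rightarrow> nat \<Rightarrow> real \<Rightarrow> real \<Rightarrow> real \<Rightarrow> graphs \<Rightarrow> outcomes \<Rightarrow> nat \<Rightarrow> real" where
  "pi_hat n T L d \<delta> t E Y = (THE x. stationary_distribution n (P_hat n T L d \<delta> t E Y) x)"

definition sup_norm :: "nat \<Rightarrow> (nat \<Rightarrow> real) \<Rightarrow> real" where
  "sup_norm n x = Max ((\<lambda>i. \<bar>x i\<bar>) ` {1..n})"

text \<open>In \<open>gamma_factor n np \<beta>\<close>, \<open>np\<close> stands for $n p_\delta(t)$ and \<open>\<beta>\<close> for $b(t)$.\<close>

definition gamma_factor :: "nat \<Rightarrow> real \<Rightarrow> real \<Rightarrow> real" where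
  "gamma_factor n np \<beta> =
     1 + \<beta> powr (5/2) / sqrt (ln (real n)) * max (\<beta>\<^sup>2) (ln (real n) / sqrt np)"

end

theory Submission
  imports Defs
begin

text \<open>
  Since $p_{\delta,sum}(t) \ge c_2 \log n$, with high probability every pair is compared at no fewer
  than $p_{\delta,sum}(t)/2$ times of the neighborhood, so the union graph is complete.  Scale the scores to
  $a_i \in [1/b, 1]$ and write the stationary distribution as $x_i = a_i (1 + u_i)$.  The balance
  equations become a perturbed Laplace equation
  $\sum_j S_{ij}(u_i - u_j) = -\sum_j e_{ij}(x_i + x_j)$, where $S_{ij} = a_i a_j/(a_i + a_j) \ge 1/(2b)$
  and $e$ is the antisymmetric matrix of errors of the empirical winning rates.  A Poincare inequality
  and an operator norm bound for $e$ give an $\ell_2$ bound on $x - a$ without logarithmic factor, and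
  comparing the equations at the maximum and at the minimum of $u$ turns it into the $\ell_\infty$ bound.
\<close>

section \<open>Stability of the balance equations\<close>

text \<open>Two noise scales are kept apart. Row sums of \<open>e\<close> are at most n \<sigma>,
  where the union over rows costs sqrt(log n). The noise part of \<kappa> is of order sqrt(n)
  \<epsilon>, with \<epsilon> the fluctuation of one entry. The obstacle is the term sum_j e_ij (x_j
  - a_j): x depends on all outcomes, so no tail bound for a fixed vector applies. It is at most
  \<kappa> times the l2 norm of x - a, which is itself at most 16 b \<kappa> / sqrt n. This uniform
  bound replaces any leave-one-out decoupling, and \<kappa> enters only squared. The noise part of
  b^2 \<kappa>^2 / n^(3/2) is then of order at most b^2 \<rho> / sqrt(log n), which the second
  summand of \<open>gamma_factor\<close> absorbs. Row bounds are needed only against the two fixed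
  vectors 1 and a, because the imbalance of a is a_i sum_j e_ij + sum_j e_ij a_j. Scores are divided
  by their maximum, so the sup norm of the target is 1 / sum_k a_k and the relative error is max_i
  |x_i - a_i| once x is scaled to the total of a. The normalization is handled by
  \<open>p_union\<close> \<ge> 1/2: it gives 3 n \<open>p_union\<close> \<ge> n, so
  \<open>P_hat\<close> is a transition matrix for every realised graph.\<close>

locale btl_perturbation =
  fixes A :: "'a set" and a :: "'a \<Rightarrow> real" and e :: "'a \<Rightarrow> 'a \<Rightarrow> real" and b \<sigma> \<kappa> :: real
  assumes finite_A: "finite A" and nonempty_A: "A \<noteq> {}"
    and b_ge_1: "1 \<le> b"
    and a_le_1: "i \<in> A \<Longrightarrow> a i \<le> 1" and a_ge: "i \<in> A \<Longrightarrow> 1 / b \<le> a i"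
    and e_antisym: "i \<in> A \<Longrightarrow> j \<in> A \<Longrightarrow> e j i = - e i j"
    and e_row: "i \<in> A \<Longrightarrow> \<bar>\<Sum>j\<in>A. e i j\<bar> \<le> card A * \<sigma>"
    and e_row_a: "i \<in> A \<Longrightarrow> \<bar>\<Sum>j\<in>A. e i j * a j\<bar> \<le> card A * \<sigma>"
    and e_bilinear: "\<And>x y. \<bar>\<Sum>i\<in>A. x i * (\<Sum>j\<in>A. e i j * y j)\<bar> \<le> \<kappa> * L2_set x A * L2_set y A"
    and \<kappa>_nonneg: "0 \<le> \<kappa>" and \<kappa>_le: "\<kappa> \<le> card A * \<sigma>"
    and \<sigma>_small: "8 * b * \<sigma> \<le> 1 / 2"
begin

text \<open>This is a_i times the noiseless probability that j beats i: the stationary flux from i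
  to j. Its symmetry is detailed balance of the noiseless chain.\<close>

definition conductance :: "'a \<Rightarrow> 'a \<Rightarrow> real" where
  "conductance i j = a i * a j / (a i + a j)"

definition win_prob :: "'a \<Rightarrow> 'a \<Rightarrow> real" where
  "win_prob i j = a j / (a i + a j) + e i j"

text \<open>Net flux out of i when mass x moves with rates \<open>win_prob\<close>. The diagonal
  term cancels, so the holding probabilities of a chain never enter.\<close>

definition imbalance :: "('a \<Rightarrow> real) \<Rightarrow> 'a \<Rightarrow> real" where
  "imbalance x i = (\<Sum>j\<in>A. x i * win_prob i j - x j * win_prob j i)"

lemma card_pos: "0 < card A"
  using finite_A nonempty_A by (simp add: card_gt_0_iff)

lemma b_pos: "0 < b"
  using b_ge_1 by simp

lemma a_pos: "i \<in> A \<Longrightarrow> 0 < a i"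
  using a_ge[of i] b_pos by (meson less_le_trans zero_less_divide_1_iff)

lemma \<sigma>_nonneg: "0 \<le> \<sigma>"
proof -
  have "0 \<le> card A * \<sigma>" using \<kappa>_nonneg \<kappa>_le by linarith
  then show ?thesis using card_pos by (simp add: zero_le_mult_iff)
qed

lemma conductance_sym: "conductance j i = conductance i j"
  by (simp add: conductance_def ac_simps)

text \<open>The conductance is the reciprocal of 1/a_i + 1/a_j, and each summand is at most
  b.\<close>

lemma conductance_ge:
  assumes "i \<in> A" "j \<in> A"
  shows "1 / (2 * b) \<le> conductance i j"
proof -
  have p: "0 < a i" "0 < a j" using assms a_pos by auto
  have "a i + a j \<le> b * a i * a j + b * a i * a j"
  proof (rule add_mono)
    have "1 \<le> b * a j" "1 \<le> b * a i" using a_ge[OF assms(2)] a_ge[OF assms(1)] b_pos by (simp_all add: field_simps)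
    then show "a i \<le> b * a i * a j" "a j \<le> b * a i * a j"
      using p by (simp_all add: mult.assoc mult.left_commute)
  qed
  then show ?thesis using p b_pos by (simp add: conductance_def field_simps)
qed

text \<open>Detailed balance makes the noiseless part a weighted Laplacian of x / a. Antisymmetry
  turns - x_j e_ji into + e_ij x_j, so the noise acts through row sums and through the product e
  x.\<close>

lemma imbalance_eq:
  assumes i: "i \<in> A"
  shows "imbalance x i =
    (\<Sum>j\<in>A. conductance i j * (x i / a i - x j / a j)) + x i * (\<Sum>j\<in>A. e i j) + (\<Sum>j\<in>A. e i j * x j)"
proof -
  have "x i * win_prob i j - x j * win_prob j i = conductance i j * (x i / a i - x j / a j) + x i * e i j + e i j * x j"
    if j: "j \<in> A" for j
  proof -
    have "conductance i j * (x i / a i) = x i * (a j / (a i + a j))" "conductance i j * (x j / a j) = x j * (a i / (a j + a i))"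
      using a_pos[OF i] a_pos[OF j] by (simp_all add: conductance_def add.commute)
    then show ?thesis
      using e_antisym[OF i j] by (simp add: win_prob_def algebra_simps)
  qed
  then show ?thesis
    by (simp add: imbalance_def sum.distrib sum_distrib_left)
qed

lemma imbalance_diff: "imbalance (\<lambda>i. x i - z i) i = imbalance x i - imbalance z i"
  by (simp add: imbalance_def sum_subtractf[symmetric] algebra_simps)

text \<open>Symmetrization writes the form as half the sum of S_ij (v_i - v_j)^2. All conductances
  are at least 1 / (2 b), and for mean-zero v the sum of (v_i - v_j)^2 over ordered pairs is 2 n
  |v|^2.\<close>

lemma poincare:
  assumes v0: "(\<Sum>i\<in>A. v i) = 0"
  shows "card A / (2 * b) * (L2_set v A)\<^sup>2 \<le> (\<Sum>i\<in>A. v i * (\<Sum>j\<in>A. conductance i j * (v i - v j)))"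
    (is "_ \<le> ?Q")
proof -
  have Q1: "?Q = (\<Sum>i\<in>A. \<Sum>j\<in>A. v i * conductance i j * (v i - v j))"
    by (simp add: sum_distrib_left mult.assoc)
  also have "\<dots> = (\<Sum>i\<in>A. \<Sum>j\<in>A. v j * conductance i j * (v j - v i))"
    by (subst sum.swap) (simp add: conductance_sym)
  finally have "2 * ?Q = (\<Sum>i\<in>A. \<Sum>j\<in>A. v i * conductance i j * (v i - v j) + v j * conductance i j * (v j - v i))"
    unfolding sum.distrib using Q1 by simp
  also have "\<dots> = (\<Sum>i\<in>A. \<Sum>j\<in>A. conductance i j * (v i - v j)\<^sup>2)"
    by (intro sum.cong refl) (simp add: power2_eq_square algebra_simps)
  finally have Q2: "2 * ?Q = (\<Sum>i\<in>A. \<Sum>j\<in>A. conductance i j * (v i - v j)\<^sup>2)" .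
  have "(\<Sum>i\<in>A. \<Sum>j\<in>A. (v i - v j)\<^sup>2)
      = (\<Sum>i\<in>A. \<Sum>j\<in>A. (v i)\<^sup>2) + (\<Sum>i\<in>A. \<Sum>j\<in>A. (v j)\<^sup>2) - 2 * (\<Sum>i\<in>A. v i * (\<Sum>j\<in>A. v j))"
    by (simp add: power2_diff sum.distrib sum_subtractf sum_distrib_left mult.assoc)
  also have "\<dots> = 2 * (card A * (L2_set v A)\<^sup>2)"
    using v0 by (simp add: L2_set_def sum_nonneg sum_distrib_left)
  finally have "1 / (2 * b) * (2 * (card A * (L2_set v A)\<^sup>2)) = 1 / (2 * b) * (\<Sum>i\<in>A. \<Sum>j\<in>A. (v i - v j)\<^sup>2)"
    by (simp only:)
  also have "\<dots> = (\<Sum>i\<in>A. \<Sum>j\<in>A. 1 / (2 * b) * (v i - v j)\<^sup>2)"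
    by (simp only: sum_distrib_left)
  also have "\<dots> \<le> 2 * ?Q"
    unfolding Q2 by (intro sum_mono mult_right_mono conductance_ge) auto
  finally have "1 / (2 * b) * (2 * (card A * (L2_set v A)\<^sup>2)) \<le> 2 * ?Q" .
  moreover have "1 / (2 * b) * (2 * (card A * (L2_set v A)\<^sup>2)) = 2 * (card A / (2 * b) * (L2_set v A)\<^sup>2)"
    by simp
  ultimately show ?thesis by linarith
qed

text \<open>The balance operator is invertible on vectors of total zero. The Laplacian part sees
  only d / a recentered to mean zero; the noise is small enough to be absorbed.\<close>

lemma L2_stability:
  assumes d0: "(\<Sum>i\<in>A. d i) = 0"
  shows "L2_set d A \<le> 8 * b / card A * L2_set (imbalance d) A"
proof -
  let ?n = "real (card A)"
  define u where "u i = d i / a i" for i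
  define m where "m = (\<Sum>i\<in>A. u i) / ?n"
  define v where "v i = u i - m" for i
  define f where "f i = imbalance d i - d i * (\<Sum>j\<in>A. e i j) - (\<Sum>j\<in>A. e i j * d j)" for i
  have n: "0 < ?n" using card_pos by simp
  have v0: "(\<Sum>i\<in>A. v i) = 0"
    using n by (simp add: v_def m_def sum_subtractf)
  have d_eq: "d i = a i * v i + m * a i" if "i \<in> A" for i
    using a_pos[OF that] by (simp add: v_def u_def field_simps)
  have Sf: "(\<Sum>j\<in>A. conductance i j * (v i - v j)) = f i" if "i \<in> A" for i
    using imbalance_eq[OF that, of d] by (simp add: f_def v_def u_def)
  have abs_a: "\<bar>a i\<bar> \<le> 1" if "i \<in> A" for i using a_le_1[OF that] a_pos[OF that] by simp

  have av: "L2_set (\<lambda>i. a i * v i) A \<le> L2_set v A"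
    unfolding L2_set_def
    by (intro real_sqrt_le_mono sum_mono) (use abs_a in \<open>auto simp: power_mult_distrib abs_square_le_1 intro!: mult_left_le_one_le\<close>)
  \<comment> \<open>No power of \<open>b\<close> is lost in recentering because $\|a\|^2 \le \sum_i a_i$.\<close>
  have d_le: "L2_set d A \<le> 2 * L2_set v A"
  proof -
    define s where "s = (\<Sum>i\<in>A. a i)"
    have s: "0 < s" unfolding s_def using finite_A nonempty_A a_pos by (intro sum_pos) auto
    have "0 = (\<Sum>i\<in>A. a i * v i) + m * s"
      using d0 by (simp add: d_eq sum.distrib s_def sum_distrib_left cong: sum.cong)
    then have "\<bar>m\<bar> * s = \<bar>\<Sum>i\<in>A. a i * v i\<bar>"
      using s by (metis abs_minus_cancel abs_mult abs_of_pos add.commute add_eq_0_iff)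
    also have "\<dots> \<le> L2_set a A * L2_set v A"
      by (rule order_trans[OF sum_abs]) (simp add: L2_set_mult_ineq abs_mult)
    finally have ms: "\<bar>m\<bar> * s \<le> L2_set a A * L2_set v A" .
    have "(L2_set a A)\<^sup>2 = (\<Sum>i\<in>A. (a i)\<^sup>2)"
      by (simp add: L2_set_def sum_nonneg)
    also have "\<dots> \<le> s" unfolding s_def
      by (intro sum_mono) (use a_le_1 a_pos in \<open>simp add: power2_eq_square less_imp_le\<close>)
    finally have as: "(L2_set a A)\<^sup>2 \<le> s" .
    have "\<bar>m\<bar> * L2_set a A * s \<le> L2_set a A * (L2_set a A * L2_set v A)"
      using mult_left_mono[OF ms, of "L2_set a A"] by (simp add: ac_simps)
    also have "\<dots> \<le> s * L2_set v A"
      using mult_right_mono[OF as, of "L2_set v A"] by (simp add: power2_eq_square ac_simps)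
    finally have ma: "\<bar>m\<bar> * L2_set a A \<le> L2_set v A" using s by simp
    have "L2_set d A = L2_set (\<lambda>i. a i * v i + m * a i) A"
      by (rule L2_set_cong) (auto simp: d_eq)
    also have "\<dots> \<le> L2_set (\<lambda>i. a i * v i) A + L2_set (\<lambda>i. m * a i) A"
      by (rule L2_set_triangle_ineq)
    also have "L2_set (\<lambda>i. m * a i) A = \<bar>m\<bar> * L2_set a A"
      by (simp add: L2_set_def power_mult_distrib sum_distrib_left[symmetric] real_sqrt_mult)
    finally show ?thesis using av ma by linarith
  qed
  \<comment> \<open>Both noise terms cost n \<sigma> |v| |d|: one by the row bound, the other by the
    operator bound together with \<kappa> \<le> n \<sigma>.\<close>
  have vf: "(\<Sum>i\<in>A. v i * f i) \<le> L2_set v A * (L2_set (imbalance d) A + 2 * (?n * \<sigma>) * L2_set d A)"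
  proof -
    have "(\<Sum>i\<in>A. v i * f i) = (\<Sum>i\<in>A. v i * imbalance d i)
        - (\<Sum>i\<in>A. v i * (d i * (\<Sum>j\<in>A. e i j))) - (\<Sum>i\<in>A. v i * (\<Sum>j\<in>A. e i j * d j))"
      by (simp add: f_def right_diff_distrib sum_subtractf)
    moreover have "(\<Sum>i\<in>A. v i * imbalance d i) \<le> L2_set v A * L2_set (imbalance d) A"
      by (rule order_trans[OF _ L2_set_mult_ineq], rule sum_mono) (simp add: abs_mult[symmetric])
    moreover have "- (\<Sum>i\<in>A. v i * (d i * (\<Sum>j\<in>A. e i j))) \<le> L2_set v A * L2_set d A * (?n * \<sigma>)"
    proof -
      have "- (\<Sum>i\<in>A. v i * (d i * (\<Sum>j\<in>A. e i j))) \<le> (\<Sum>i\<in>A. \<bar>v i * (d i * (\<Sum>j\<in>A. e i j))\<bar>)"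
        by (rule order_trans[OF abs_ge_minus_self sum_abs])
      also have "\<dots> \<le> (\<Sum>i\<in>A. \<bar>v i\<bar> * \<bar>d i\<bar> * (?n * \<sigma>))"
        unfolding abs_mult mult.assoc[symmetric, of "\<bar>v _\<bar>"]
        by (intro sum_mono mult_left_mono e_row) auto
      also have "\<dots> = (\<Sum>i\<in>A. \<bar>v i\<bar> * \<bar>d i\<bar>) * (?n * \<sigma>)" by (simp add: sum_distrib_right)
      also have "\<dots> \<le> L2_set v A * L2_set d A * (?n * \<sigma>)"
        using \<sigma>_nonneg by (intro mult_right_mono L2_set_mult_ineq) auto
      finally show ?thesis .
    qed
    moreover have "- (\<Sum>i\<in>A. v i * (\<Sum>j\<in>A. e i j * d j)) \<le> L2_set v A * L2_set d A * (?n * \<sigma>)"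
    proof -
      have "- (\<Sum>i\<in>A. v i * (\<Sum>j\<in>A. e i j * d j)) \<le> \<kappa> * (L2_set v A * L2_set d A)"
        using e_bilinear[of v d] by (simp add: mult.assoc)
      also have "\<dots> \<le> (?n * \<sigma>) * (L2_set v A * L2_set d A)"
        using \<kappa>_le by (intro mult_right_mono) auto
      finally show ?thesis by (simp add: ac_simps)
    qed
    ultimately show ?thesis by (simp add: algebra_simps)
  qed
  have "?n / (2 * b) * (L2_set v A)\<^sup>2 \<le> (\<Sum>i\<in>A. v i * f i)"
    using poincare[OF v0] by (simp add: Sf cong: sum.cong)
  with vf have le: "?n / (2 * b) * L2_set v A * L2_set v A
      \<le> (L2_set (imbalance d) A + 2 * (?n * \<sigma>) * L2_set d A) * L2_set v A"
    by (simp add: power2_eq_square ac_simps)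
  have "?n / (2 * b) * L2_set v A \<le> L2_set (imbalance d) A + 2 * (?n * \<sigma>) * L2_set d A"
  proof (cases "L2_set v A = 0")
    case False
    then have "0 < L2_set v A" by (simp add: order_less_le)
    then show ?thesis using le mult_right_le_imp_le by blast
  qed (use \<sigma>_nonneg in \<open>simp add: add_nonneg_nonneg mult_nonneg_nonneg\<close>)
  then have "?n * L2_set v A \<le> 2 * b * L2_set (imbalance d) A + ?n * (4 * b * \<sigma>) * L2_set d A"
    using b_pos by (simp add: field_simps)
  \<comment> \<open>The quarter becomes one half after |d| \<le> 2 |v|, and is then absorbed on the
    left.\<close>
  also have "?n * (4 * b * \<sigma>) * L2_set d A \<le> ?n * (1 / 4) * L2_set d A"
    using \<sigma>_small by (intro mult_left_mono mult_right_mono) auto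
  finally have "?n * L2_set v A \<le> 2 * b * L2_set (imbalance d) A + ?n * (1 / 4) * L2_set d A"
    by simp
  moreover have "?n * L2_set d A \<le> 2 * (?n * L2_set v A)"
    using mult_left_mono[OF d_le, of ?n] n by simp
  ultimately have "?n * L2_set d A \<le> 4 * b * L2_set (imbalance d) A + ?n * (1 / 2) * L2_set d A"
    by simp
  then show ?thesis using n by (simp add: field_simps)
qed

text \<open>The balance equations are linear, so the difference of two solutions of equal total has
  imbalance zero and vanishes by stability. This replaces an irreducibility argument.\<close>

lemma balanced_unique:
  assumes "\<And>i. i \<in> A \<Longrightarrow> imbalance x i = 0" "\<And>i. i \<in> A \<Longrightarrow> imbalance z i = 0"
    and "(\<Sum>i\<in>A. x i) = (\<Sum>i\<in>A. z i)" and "i \<in> A"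
  shows "x i = z i"
proof -
  have "L2_set (\<lambda>i. x i - z i) A \<le> 8 * b / card A * L2_set (imbalance (\<lambda>i. x i - z i)) A"
    by (rule L2_stability) (simp add: sum_subtractf assms)
  also have "L2_set (imbalance (\<lambda>i. x i - z i)) A = 0"
    using finite_A assms(1,2) by (subst L2_set_eq_0_iff) (auto simp: imbalance_diff)
  finally have "L2_set (\<lambda>i. x i - z i) A = 0" by (simp add: order_antisym)
  then show ?thesis using finite_A assms(4) by (simp add: L2_set_eq_0_iff)
qed

text \<open>Stability gives an l2 bound proportional to \<kappa>. It is spent only on the term where
  e multiplies the unknown error; everything else in an equation is bounded through \<sigma>, and a
  maximum principle passes to the sup norm.\<close>

lemma balanced_close:
  assumes bal: "\<And>i. i \<in> A \<Longrightarrow> imbalance x i = 0"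
    and sum_x: "(\<Sum>i\<in>A. x i) = (\<Sum>i\<in>A. a i)" and i: "i \<in> A"
  shows "\<bar>x i - a i\<bar> \<le> 16 * b * \<sigma> + 128 * b\<^sup>2 * \<kappa>\<^sup>2 / (card A * sqrt (card A))"
proof -
  let ?n = "real (card A)"
  have n: "0 < ?n" using card_pos by simp
  define d where "d i = x i - a i" for i
  define u where "u i = d i / a i" for i
  define r where "r i = a i * (\<Sum>j\<in>A. e i j) + (\<Sum>j\<in>A. e i j * a j)" for i
  have imb_d: "imbalance d i = - r i" if "i \<in> A" for i
  proof -
    \<comment> \<open>The Laplacian part vanishes at x = a, because a / a is constant; only noise
      remains.\<close>
    have "imbalance a i = r i"
      using a_pos unfolding imbalance_eq[OF that] r_def 
      by (simp add: that less_imp_neq[THEN not_sym] cong: sum.cong)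
    then show ?thesis using imbalance_diff[of x a i] bal[OF that] by (simp add: d_def[abs_def])
  qed
  have bil_le: "L2_set (\<lambda>i. \<Sum>j\<in>A. e i j * z j) A \<le> \<kappa> * L2_set z A" for z
  proof -
    let ?w = "\<lambda>i. \<Sum>j\<in>A. e i j * z j"
    \<comment> \<open>Testing the bilinear form with the image of z itself turns the form bound into
      a bound on that image.\<close>
    have "L2_set ?w A * L2_set ?w A = (\<Sum>i\<in>A. ?w i * ?w i)"
      by (simp add: L2_set_def sum_nonneg power2_eq_square)
    also have "\<dots> \<le> \<kappa> * L2_set ?w A * L2_set z A" using e_bilinear[of ?w z] by linarith
    finally have "L2_set ?w A * L2_set ?w A \<le> \<kappa> * L2_set z A * L2_set ?w A" by (simp add: ac_simps)
    then show ?thesis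
      by (cases "L2_set ?w A = 0") (use \<kappa>_nonneg L2_set_nonneg[of ?w A] in \<open>auto simp: mult_le_cancel_right\<close>)
  qed
  have const: "L2_set (\<lambda>_. 1) A = sqrt ?n" by (simp add: L2_set_def)
  have a_norm: "L2_set a A \<le> sqrt ?n"
    unfolding const[symmetric] by (intro L2_set_mono) (use a_le_1 a_pos in \<open>auto simp: less_imp_le\<close>)
  have r_norm: "L2_set r A \<le> 2 * \<kappa> * sqrt ?n"
  proof -
    have "L2_set r A \<le> L2_set (\<lambda>i. a i * (\<Sum>j\<in>A. e i j)) A + L2_set (\<lambda>i. \<Sum>j\<in>A. e i j * a j) A"
      unfolding r_def by (rule L2_set_triangle_ineq)
    also have "L2_set (\<lambda>i. a i * (\<Sum>j\<in>A. e i j)) A \<le> L2_set (\<lambda>i. \<Sum>j\<in>A. e i j * 1) A"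
      unfolding L2_set_def
      by (intro real_sqrt_le_mono sum_mono) (use a_le_1 a_pos in \<open>auto simp: less_imp_le power_mult_distrib abs_square_le_1 intro!: mult_left_le_one_le\<close>)
    also have "\<dots> \<le> \<kappa> * sqrt ?n" using bil_le[of "\<lambda>_. 1"] const by simp
    also have "L2_set (\<lambda>i. \<Sum>j\<in>A. e i j * a j) A \<le> \<kappa> * sqrt ?n"
      using order_trans[OF bil_le mult_left_mono[OF a_norm \<kappa>_nonneg]] .
    finally show ?thesis by simp
  qed
  have "L2_set d A \<le> 8 * b / ?n * L2_set (imbalance d) A"
    by (rule L2_stability) (simp add: d_def sum_subtractf sum_x)
  also have "L2_set (imbalance d) A = L2_set r A"
    unfolding L2_set_def by (simp add: imb_d cong: sum.cong)
  also have "8 * b / ?n * L2_set r A \<le> 8 * b / ?n * (2 * \<kappa> * sqrt ?n)"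
    using b_pos r_norm by (intro mult_left_mono) auto
  also have "\<dots> = 16 * b * \<kappa> / sqrt ?n"
    using n by (simp add: field_simps)
  finally have d_norm: "L2_set d A \<le> 16 * b * \<kappa> / sqrt ?n" .

  define U where "U = Max ((\<lambda>i. \<bar>u i\<bar>) ` A)"
  have U: "\<bar>u i\<bar> \<le> U" if "i \<in> A" for i
    unfolding U_def using finite_A that by (intro Max_ge) auto
  have U_nonneg: "0 \<le> U" using U[OF i] by linarith
  have d_u: "d i = a i * u i" if "i \<in> A" for i using a_pos[OF that] by (simp add: u_def)
  have d_le: "\<bar>d i\<bar> \<le> \<bar>u i\<bar>" if "i \<in> A" for i
    using a_pos[OF that] a_le_1[OF that] d_u[OF that] by (simp add: abs_mult mult_left_le_one_le)
  define F where "F = 2 * (?n * \<sigma>) + ?n * \<sigma> * U + 16 * b * \<kappa>\<^sup>2 / sqrt ?n"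
  have flow: "\<bar>\<Sum>j\<in>A. conductance i j * (u i - u j)\<bar> \<le> F" if i: "i \<in> A" for i
  proof -
    have "(\<Sum>j\<in>A. conductance i j * (u i - u j)) = - r i - d i * (\<Sum>j\<in>A. e i j) - (\<Sum>j\<in>A. e i j * d j)"
      using imbalance_eq[OF i, of d] imb_d[OF i] by (simp add: u_def)
    then have "\<bar>\<Sum>j\<in>A. conductance i j * (u i - u j)\<bar> \<le> \<bar>r i\<bar> + \<bar>d i * (\<Sum>j\<in>A. e i j)\<bar> + \<bar>\<Sum>j\<in>A. e i j * d j\<bar>"
      by linarith
    moreover have "\<bar>r i\<bar> \<le> 2 * (?n * \<sigma>)"
    proof -
      have "\<bar>a i * (\<Sum>j\<in>A. e i j)\<bar> \<le> 1 * (?n * \<sigma>)"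
        unfolding abs_mult using e_row[OF i] a_le_1[OF i] a_pos[OF i] by (intro mult_mono) auto
      then show ?thesis using e_row_a[OF i] unfolding r_def by linarith
    qed
    moreover have "\<bar>d i * (\<Sum>j\<in>A. e i j)\<bar> \<le> U * (?n * \<sigma>)"
      unfolding abs_mult using e_row[OF i] order_trans[OF d_le[OF i] U[OF i]] U_nonneg by (intro mult_mono) auto
    moreover have "\<bar>\<Sum>j\<in>A. e i j * d j\<bar> \<le> \<kappa> * (16 * b * \<kappa> / sqrt ?n)"
    proof -
      \<comment> \<open>The form is tested with the unit vector at i. The bound holds for every d,
        so the dependence of d on the noise is harmless.\<close>
      have "\<bar>\<Sum>j\<in>A. e i j * d j\<bar> \<le> \<kappa> * L2_set (\<lambda>k. if k = i then 1 else 0) A * L2_set d A"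
        using e_bilinear[of "\<lambda>k. if k = i then 1 else 0" d] i finite_A
        by (simp add: if_distrib[of "\<lambda>x. x * _"] sum.delta cong: if_cong)
      also have "L2_set (\<lambda>k. if k = i then 1 else 0) A = 1"
        using i finite_A by (simp add: L2_set_def if_distrib[of "\<lambda>x. x ^ 2"] sum.delta cong: if_cong)
      finally have "\<bar>\<Sum>j\<in>A. e i j * d j\<bar> \<le> \<kappa> * L2_set d A" by simp
      then show ?thesis using mult_left_mono[OF d_norm \<kappa>_nonneg] by linarith
    qed
    ultimately show ?thesis by (simp add: F_def power2_eq_square algebra_simps)
  qed

  \<comment> \<open>Summing the equations at the maximum and at the minimum of \<open>u\<close> bounds \<open>card A * (max u - min u)\<close>.\<close>
  have "Max (u ` A) \<in> u ` A" "Min (u ` A) \<in> u ` A"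
    using finite_A nonempty_A by simp_all
  then obtain p q where pq: "p \<in> A" "u p = Max (u ` A)" "q \<in> A" "u q = Min (u ` A)" by force
  then have p: "p \<in> A" "\<And>i. i \<in> A \<Longrightarrow> u i \<le> u p" and q: "q \<in> A" "\<And>i. i \<in> A \<Longrightarrow> u q \<le> u i"
    using finite_A by simp_all
  have "1 / (2 * b) * (\<Sum>j\<in>A. u p - u j) \<le> (\<Sum>j\<in>A. conductance p j * (u p - u j))"
    unfolding sum_distrib_left using p by (intro sum_mono mult_right_mono conductance_ge) auto
  moreover have "1 / (2 * b) * (\<Sum>j\<in>A. u j - u q) \<le> (\<Sum>j\<in>A. conductance q j * (u j - u q))"
    unfolding sum_distrib_left using q by (intro sum_mono mult_right_mono conductance_ge) auto
  moreover have "(\<Sum>j\<in>A. conductance q j * (u j - u q)) = - (\<Sum>j\<in>A. conductance q j * (u q - u j))"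
    by (simp add: sum_negf[symmetric] algebra_simps)
  moreover have "(\<Sum>j\<in>A. u p - u j) + (\<Sum>j\<in>A. u j - u q) = ?n * (u p - u q)"
    by (simp add: sum.distrib[symmetric])
  ultimately have "1 / (2 * b) * (?n * (u p - u q)) \<le> 2 * F"
    using flow[OF p(1)] flow[OF q(1)] by (simp only: distrib_left[symmetric]) (smt (verit) distrib_left)
  then have range: "?n * (u p - u q) \<le> 4 * b * F" using b_pos by (simp add: field_simps)

  \<comment> \<open>The totals agree and the weights a are positive, so u cannot have a strict sign.
    Hence its range dominates its sup norm.\<close>
  have au: "(\<Sum>i\<in>A. a i * u i) = 0"
    using sum_x by (simp add: d_u[symmetric] d_def sum_subtractf cong: sum.cong)
  have "0 \<le> u p"
  proof (rule ccontr)
    assume "\<not> 0 \<le> u p"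
    then have "a i * u i < 0" if "i \<in> A" for i
      using p(2)[OF that] a_pos[OF that] by (intro mult_pos_neg) auto
    then have "(\<Sum>i\<in>A. a i * u i) < (\<Sum>i\<in>A. 0)"
      using finite_A nonempty_A by (intro sum_strict_mono) auto
    then show False using au by simp
  qed
  moreover have "u q \<le> 0"
  proof (rule ccontr)
    assume "\<not> u q \<le> 0"
    then have "0 < a i * u i" if "i \<in> A" for i
      using q(2)[OF that] a_pos[OF that] by (intro mult_pos_pos) auto
    then have "(\<Sum>i\<in>A. 0) < (\<Sum>i\<in>A. a i * u i)"
      using finite_A nonempty_A by (intro sum_strict_mono) auto
    then show False using au by simp
  qed
  ultimately have "\<bar>u i\<bar> \<le> u p - u q" if "i \<in> A" for i
    using p(2)[OF that] q(2)[OF that] by linarith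
  then have "U \<le> u p - u q" unfolding U_def using finite_A nonempty_A by simp
  then have "?n * U \<le> 4 * b * F" using range mult_left_mono[of U "u p - u q" ?n] n by linarith
  also have "4 * b * F = ?n * (8 * b * \<sigma>) + ?n * (4 * b * \<sigma>) * U + 64 * b\<^sup>2 * \<kappa>\<^sup>2 / sqrt ?n"
    by (simp add: F_def power2_eq_square algebra_simps)
  also have "?n * (4 * b * \<sigma>) * U \<le> ?n * (1 / 2) * U"
    using \<sigma>_small b_pos \<sigma>_nonneg U_nonneg by (intro mult_right_mono mult_left_mono) auto
  finally have "?n * U \<le> ?n * (16 * b * \<sigma>) + 128 * b\<^sup>2 * \<kappa>\<^sup>2 / sqrt ?n" by simp
  then have "U \<le> 16 * b * \<sigma> + 128 * b\<^sup>2 * \<kappa>\<^sup>2 / (?n * sqrt ?n)"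
    using n by (simp add: field_simps)
  then show ?thesis using d_le[OF i] U[OF i] by (simp add: d_def)
qed

end

text \<open>
  State elimination: the chain watched only while it is in \<open>A\<close> has the rates \<open>q'\<close> below, and its
  balanced vector extends to the eliminated state \<open>a\<close>.
\<close>
lemma ex_balanced:
  fixes q :: "'a \<Rightarrow> 'a \<Rightarrow> real"
  assumes "finite A" "A \<noteq> {}" "\<And>i j. i \<in> A \<Longrightarrow> j \<in> A \<Longrightarrow> 0 \<le> q i j"
  shows "\<exists>x. (\<forall>i\<in>A. 0 \<le> x i) \<and> 0 < (\<Sum>i\<in>A. x i) \<and>
    (\<forall>i\<in>A. (\<Sum>j\<in>A. x i * q i j) = (\<Sum>j\<in>A. x j * q j i))"
  using assms
proof (induction A arbitrary: q rule: finite_ne_induct)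
  case (singleton a)
  show ?case by (rule exI[of _ "\<lambda>_. 1"]) simp
next
  case (insert a A)
  define Q where "Q = (\<Sum>k\<in>A. q a k)"
  have Q: "0 \<le> Q" unfolding Q_def using insert.prems by (intro sum_nonneg) auto
  show ?case
  proof (cases "Q = 0")
    \<comment> \<open>No rate leads from \<open>a\<close> into \<open>A\<close>, so the point mass
      at \<open>a\<close> is balanced.\<close>
    case True
    then have "q a k = 0" if "k \<in> A" for k
      using that insert.hyps insert.prems by (simp add: Q_def sum_nonneg_eq_0_iff)
    moreover have "i \<noteq> a" if "i \<in> A" for i using that insert.hyps by auto
    ultimately show ?thesis
      using insert.hyps by (intro exI[of _ "\<lambda>i. if i = a then 1 else 0"]) (auto simp: if_distrib[of "\<lambda>x. x * _"] cong: if_cong)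
  next
    case False
    then have Q: "0 < Q" using Q by simp
    \<comment> \<open>A jump to \<open>a\<close> is followed by an exit to j with probability
      \<open>q a j / Q\<close>. Excursions returning to i go into \<open>q' i i\<close>, which
      cancels in the balance equation.\<close>
    define q' where "q' i j = q i j + q i a * q a j / Q" for i j
    have "\<exists>x. (\<forall>i\<in>A. 0 \<le> x i) \<and> 0 < (\<Sum>i\<in>A. x i) \<and>
        (\<forall>i\<in>A. (\<Sum>j\<in>A. x i * q' i j) = (\<Sum>j\<in>A. x j * q' j i))"
      using Q insert.prems by (intro insert.IH) (auto simp: q'_def)
    then obtain x where x: "\<And>i. i \<in> A \<Longrightarrow> 0 \<le> x i" "0 < (\<Sum>i\<in>A. x i)"
      "\<And>i. i \<in> A \<Longrightarrow> (\<Sum>j\<in>A. x i * q' i j) = (\<Sum>j\<in>A. x j * q' j i)" by blast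
    \<comment> \<open>This mass at \<open>a\<close> makes its outflow c Q equal to its
      inflow.\<close>
    define c where "c = (\<Sum>j\<in>A. x j * q j a) / Q"
    have c: "0 \<le> c" unfolding c_def using Q x(1) insert.prems by (intro divide_nonneg_pos sum_nonneg mult_nonneg_nonneg) auto
    define x' where "x' = x(a := c)"
    have x'A: "x' i = x i" if "i \<in> A" for i using that insert.hyps by (auto simp: x'_def)
    have x'a: "x' a = c" by (simp add: x'_def)
    have "(\<Sum>j\<in>insert a A. x' i * q i j) = (\<Sum>j\<in>insert a A. x' j * q j i)" if i: "i \<in> insert a A" for i
    proof (cases "i = a")
      case True
      have "(\<Sum>j\<in>A. c * q a j) = (\<Sum>j\<in>A. x j * q j a)"
        using Q by (simp add: sum_distrib_left[symmetric] Q_def[symmetric]) (simp add: c_def)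
      then show ?thesis using True insert.hyps by (simp add: x'a x'A cong: sum.cong)
    next
      case False
      then have iA: "i \<in> A" using i by simp
      have l: "(\<Sum>j\<in>A. x i * q' i j) = (\<Sum>j\<in>A. x i * q i j) + x i * q i a / Q * (\<Sum>j\<in>A. q a j)"
        by (simp add: q'_def algebra_simps sum.distrib sum_distrib_left sum_divide_distrib)
      have Qa: "x i * q i a / Q * (\<Sum>j\<in>A. q a j) = x i * q i a"
        unfolding Q_def[symmetric] using Q by simp
      have r: "(\<Sum>j\<in>A. x j * q' j i) = (\<Sum>j\<in>A. x j * q j i) + c * q a i"
        by (simp add: q'_def c_def algebra_simps sum.distrib sum_distrib_left sum_divide_distrib)
      have "(\<Sum>j\<in>A. x i * q i j) + x i * q i a = (\<Sum>j\<in>A. x j * q j i) + c * q a i"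
        using x(3)[OF iA] unfolding l Qa r .
      then show ?thesis using iA insert.hyps by (simp add: x'a x'A cong: sum.cong)
    qed
    moreover have "0 < (\<Sum>i\<in>insert a A. x' i)"
      using insert.hyps x(2) c by (simp add: x'a x'A cong: sum.cong)
    moreover have "\<forall>i\<in>insert a A. 0 \<le> x' i" using x(1) c by (simp add: x'a x'A)
    ultimately show ?thesis by blast
  qed
qed

section \<open>Concentration of random bilinear forms\<close>

text \<open>The upper bound V in place of the exact sum of squares allows one tail for all
  coefficient vectors of bounded size. Vanishing coefficients are separated because Hoeffding's
  inequality divides by the sum of squares.\<close>

lemma Hoeffding_bernoulli:
  fixes c q :: "'a \<Rightarrow> real"
  assumes I: "finite I" and q: "\<And>k. k \<in> I \<Longrightarrow> 0 \<le> q k \<and> q k \<le> 1"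
    and V: "(\<Sum>k\<in>I. (c k)\<^sup>2) \<le> V" and s: "0 < s"
  shows "measure_pmf.prob (Pi_pmf I False (\<lambda>k. bernoulli_pmf (q k)))
           {Y. s \<le> (\<Sum>k\<in>I. c k * (of_bool (Y k) - q k))} \<le> exp (- 2 * s\<^sup>2 / V)"
proof (cases "(\<Sum>k\<in>I. (c k)\<^sup>2) = 0")
  case True
  then have "c k = 0" if "k \<in> I" for k
    using I that by (subst (asm) sum_nonneg_eq_0_iff) auto
  then have "(\<Sum>k\<in>I. c k * (of_bool (Y k) - q k)) = 0" for Y :: "'a \<Rightarrow> bool" by simp
  then show ?thesis using s by simp
next
  case False
  let ?M = "Pi_pmf I False (\<lambda>k. bernoulli_pmf (q k))"
  define X where "X = (\<lambda>k (Y :: 'a \<Rightarrow> bool). c k * of_bool (Y k))"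
  define \<mu> where "\<mu> = (\<Sum>k\<in>I. measure_pmf.expectation ?M (X k))"
  have mean: "measure_pmf.expectation ?M (X k) = c k * q k" if k: "k \<in> I" for k
  proof -
    have "measure_pmf.expectation ?M (X k)
        = measure_pmf.expectation (map_pmf (\<lambda>Y. Y k) ?M) (\<lambda>y. c k * of_bool y)"
      by (simp add: X_def)
    also have "\<dots> = c k * q k" using k I q by (simp add: Pi_pmf_component)
    finally show ?thesis .
  qed
  \<comment> \<open>The variable \<open>X k\<close> takes the values 0 and \<open>c k\<close>, so
    its range has width |c_k| whatever the sign.\<close>
  interpret Hoeffding_ineq "measure_pmf ?M" I X "\<lambda>k. min 0 (c k)" "\<lambda>k. max 0 (c k)" \<mu>
  proof unfold_locales
    show "prob_space.indep_vars (measure_pmf ?M) (\<lambda>_. borel) X I"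
      unfolding X_def
      by (rule prob_space.indep_vars_compose2[OF measure_pmf.prob_space_axioms indep_vars_Pi_pmf[OF I]]) auto
  qed (use I in \<open>auto simp: X_def \<mu>_def\<close>)
  have \<mu>_eq: "\<mu> = (\<Sum>k\<in>I. c k * q k)" by (simp add: \<mu>_def mean cong: sum.cong)
  have w: "(\<Sum>k\<in>I. (max 0 (c k) - min 0 (c k))\<^sup>2) = (\<Sum>k\<in>I. (c k)\<^sup>2)"
    by (intro sum.cong refl) (simp add: max_def min_def)
  have pos: "0 < (\<Sum>k\<in>I. (c k)\<^sup>2)" using False by (simp add: sum_nonneg order_less_le)
  have "{Y. s \<le> (\<Sum>k\<in>I. c k * (of_bool (Y k) - q k))} = {Y. \<mu> + s \<le> (\<Sum>k\<in>I. X k Y)}"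
    by (auto simp: \<mu>_eq X_def right_diff_distrib sum_subtractf)
  then have "measure_pmf.prob ?M {Y. s \<le> (\<Sum>k\<in>I. c k * (of_bool (Y k) - q k))}
      \<le> exp (- 2 * s\<^sup>2 / (\<Sum>k\<in>I. (c k)\<^sup>2))"
    using Hoeffding_ineq_ge[of s] s pos by (simp add: w)
  also have "\<dots> \<le> exp (- 2 * s\<^sup>2 / V)"
    using V pos by (simp add: frac_le)
  finally show ?thesis .
qed

text \<open>Random variables exist only for i < j; this folds a double sum onto that
  triangle.\<close>

lemma sum_square_split:
  fixes g :: "nat \<Rightarrow> nat \<Rightarrow> real"
  shows "(\<Sum>i\<in>{1..n}. \<Sum>j\<in>{1..n}. g i j)
    = (\<Sum>i\<in>{1..n}. \<Sum>j\<in>{i<..n}. g i j + g j i) + (\<Sum>i\<in>{1..n}. g i i)"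
proof -
  have row: "(\<Sum>j\<in>{1..n}. g i j) = (\<Sum>j\<in>{i<..n}. g i j) + (\<Sum>j | j \<in> {1..n} \<and> j < i. g i j) + g i i"
    if i: "i \<in> {1..n}" for i
  proof -
    have "{1..n} = insert i ({i<..n} \<union> {j. j \<in> {1..n} \<and> j < i})" using i by auto
    then have "(\<Sum>j\<in>{1..n}. g i j) = (\<Sum>j\<in>insert i ({i<..n} \<union> {j. j \<in> {1..n} \<and> j < i}). g i j)"
      by (rule arg_cong[where f = "sum (g i)"])
    also have "\<dots> = g i i + (\<Sum>j\<in>{i<..n} \<union> {j. j \<in> {1..n} \<and> j < i}. g i j)"
      by (rule sum.insert) auto
    also have "(\<Sum>j\<in>{i<..n} \<union> {j. j \<in> {1..n} \<and> j < i}. g i j)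
      = (\<Sum>j\<in>{i<..n}. g i j) + (\<Sum>j | j \<in> {1..n} \<and> j < i. g i j)"
      by (rule sum.union_disjoint) auto
    finally show ?thesis by simp
  qed
  have "(\<Sum>i\<in>{1..n}. \<Sum>j | j \<in> {1..n} \<and> j < i. g i j) = (\<Sum>j\<in>{1..n}. \<Sum>i | i \<in> {1..n} \<and> j < i. g i j)"
    by (rule sum.swap_restrict) auto
  also have "\<dots> = (\<Sum>j\<in>{1..n}. \<Sum>i\<in>{j<..n}. g i j)"
    by (intro sum.cong) auto
  finally show ?thesis
    using row by (simp add: sum.distrib)
qed

text \<open>Lagrange's identity: the left side is |x|^2 |z|^2 minus the squared inner product. Its
  summands are the squared coefficients of an antisymmetric form at x and z.\<close>

lemma Lagrange_identity_le:
  fixes x z :: "nat \<Rightarrow> real"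
  shows "(\<Sum>i\<in>{1..n}. \<Sum>j\<in>{i<..n}. (x i * z j - x j * z i)\<^sup>2)
    \<le> (\<Sum>i\<in>{1..n}. (x i)\<^sup>2) * (\<Sum>i\<in>{1..n}. (z i)\<^sup>2)"
proof -
  let ?g = "\<lambda>i j. (x i * z j - x j * z i)\<^sup>2 / 2"
  have "(\<Sum>i\<in>{1..n}. \<Sum>j\<in>{i<..n}. (x i * z j - x j * z i)\<^sup>2) = (\<Sum>i\<in>{1..n}. \<Sum>j\<in>{i<..n}. ?g i j + ?g j i)"
    by (intro sum.cong refl) (simp add: power2_commute)
  also have "\<dots> = (\<Sum>i\<in>{1..n}. \<Sum>j\<in>{1..n}. ?g i j)"
    unfolding sum_square_split[of ?g] by simp
  also have "\<dots> = (\<Sum>i\<in>{1..n}. \<Sum>j\<in>{1..n}. (x i)\<^sup>2 * (z j)\<^sup>2 / 2 + (x j)\<^sup>2 * (z i)\<^sup>2 / 2 - (x i * z i) * (x j * z j))"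
    by (intro sum.cong refl) (simp add: power2_eq_square field_simps)
  also have "\<dots> = (\<Sum>i\<in>{1..n}. (x i)\<^sup>2) * (\<Sum>i\<in>{1..n}. (z i)\<^sup>2) / 2
      + (\<Sum>i\<in>{1..n}. \<Sum>j\<in>{1..n}. (x j)\<^sup>2 * (z i)\<^sup>2 / 2) - (\<Sum>i\<in>{1..n}. x i * z i)\<^sup>2"
    by (simp add: sum.distrib sum_subtractf sum_product sum_divide_distrib power2_eq_square)
  also have "(\<Sum>i\<in>{1..n}. \<Sum>j\<in>{1..n}. (x j)\<^sup>2 * (z i)\<^sup>2 / 2) = (\<Sum>i\<in>{1..n}. (x i)\<^sup>2) * (\<Sum>i\<in>{1..n}. (z i)\<^sup>2) / 2"
    by (subst sum.swap) (simp add: sum_product sum_divide_distrib)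
  finally show ?thesis by simp
qed

section \<open>Lattice nets for bounding operator norms\<close>

text \<open>The subtracted geometric term makes the induction close: the two new terms are at most 2
  * (1/2)^(m+1), exactly the increment of the right side.\<close>

lemma sum_gaussian_le: "(\<Sum>k\<in>{- int m..int m}. exp (- (real_of_int k)\<^sup>2)) \<le> 3 - 2 * (1 / 2) ^ m"
proof (induction m)
  case (Suc m)
  have "{- int (Suc m)..int (Suc m)} = insert (- int (Suc m)) (insert (int (Suc m)) {- int m..int m})"
    by auto
  then have "(\<Sum>k\<in>{- int (Suc m)..int (Suc m)}. exp (- (real_of_int k)\<^sup>2))
      = 2 * exp (- (real (Suc m))\<^sup>2) + (\<Sum>k\<in>{- int m..int m}. exp (- (real_of_int k)\<^sup>2))"
    by (simp add: power2_eq_square algebra_simps)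
  moreover have "exp (- (real (Suc m))\<^sup>2) \<le> (1 / 2) ^ Suc m"
  proof -
    have "exp (- (real (Suc m))\<^sup>2) \<le> exp (real (Suc m) * (- 1))"
      by (simp add: power2_eq_square algebra_simps)
    also have "\<dots> = exp (- 1) ^ Suc m" by (rule exp_of_nat_mult)
    also have "\<dots> \<le> (1 / 2) ^ Suc m"
      using exp_ge_add_one_self[of 1] by (intro power_mono) (auto simp: exp_minus field_simps)
    finally show ?thesis .
  qed
  ultimately show ?case using Suc by simp
qed simp

text \<open>The integer points serve as an explicit net whose size can be counted. The box places
  them in a finite product, over which sums factor by coordinates.\<close>

definition lattice_ball :: "'a set \<Rightarrow> nat \<Rightarrow> ('a \<Rightarrow> int) set" where
  "lattice_ball A m = {k \<in> A \<rightarrow>\<^sub>E {- int m..int m}. (\<Sum>i\<in>A. (k i)\<^sup>2) \<le> int m}"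

lemma finite_lattice_ball: "finite A \<Longrightarrow> finite (lattice_ball A m)"
  by (rule finite_subset[of _ "A \<rightarrow>\<^sub>E {- int m..int m}"]) (auto simp: lattice_ball_def intro: finite_PiE)

text \<open>Exponential counting: each point of the ball has weight exp(m - |k|^2) \<ge> 1. Summed
  over the box, the weights factor into one-dimensional Gaussian sums, each at most 3 \<le> exp
  2.\<close>

lemma card_lattice_ball:
  assumes A: "finite A"
  shows "card (lattice_ball A m) \<le> exp (real m + 2 * real (card A))"
proof -
  have "real (card (lattice_ball A m)) = (\<Sum>k\<in>lattice_ball A m. 1)" by simp
  also have "\<dots> \<le> (\<Sum>k\<in>lattice_ball A m. exp m * (\<Prod>i\<in>A. exp (- (real_of_int (k i))\<^sup>2)))"
  proof (rule sum_mono)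
    fix k assume "k \<in> lattice_ball A m"
    then have "(\<Sum>i\<in>A. (k i)\<^sup>2) \<le> int m" by (simp add: lattice_ball_def)
    then have "real_of_int (\<Sum>i\<in>A. (k i)\<^sup>2) \<le> real m" by linarith
    then show "1 \<le> exp m * (\<Prod>i\<in>A. exp (- (real_of_int (k i))\<^sup>2))"
      using A by (simp add: exp_sum[symmetric] exp_add[symmetric] sum_negf)
  qed
  also have "\<dots> \<le> (\<Sum>k\<in>A \<rightarrow>\<^sub>E {- int m..int m}. exp m * (\<Prod>i\<in>A. exp (- (real_of_int (k i))\<^sup>2)))"
    using A by (intro sum_mono2 finite_PiE) (auto simp: lattice_ball_def intro!: mult_nonneg_nonneg prod_nonneg)
  also have "\<dots> = exp m * (\<Prod>i\<in>A. \<Sum>k\<in>{- int m..int m}. exp (- (real_of_int k)\<^sup>2))"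
    using A by (subst prod_sum_PiE) (auto simp: sum_distrib_left)
  also have "\<dots> \<le> exp m * (\<Prod>i\<in>A. exp 2)"
  proof (intro mult_left_mono prod_mono conjI sum_nonneg)
    have "0 \<le> (1 / 2 :: real) ^ m" by simp
    then show "(\<Sum>k\<in>{- int m..int m}. exp (- (real_of_int k)\<^sup>2)) \<le> exp 2"
      using sum_gaussian_le[of m] exp_ge_add_one_self[of 2] by linarith
  qed auto
  also have "\<dots> = exp (real m + 2 * real (card A))"
    by (simp add: exp_add exp_of_nat_mult[symmetric] mult.commute)
  finally show ?thesis .
qed

definition bilin :: "'a set \<Rightarrow> ('a \<Rightarrow> 'a \<Rightarrow> real) \<Rightarrow> ('a \<Rightarrow> real) \<Rightarrow> ('a \<Rightarrow> real) \<Rightarrow> real" where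
  "bilin A e x z = (\<Sum>i\<in>A. x i * (\<Sum>j\<in>A. e i j * z j))"

lemma bilin_add_left: "bilin A e (\<lambda>i. x i + x' i) z = bilin A e x z + bilin A e x' z"
  and bilin_add_right: "bilin A e x (\<lambda>i. z i + z' i) = bilin A e x z + bilin A e x z'"
  and bilin_scale_left: "bilin A e (\<lambda>i. c * x i) z = c * bilin A e x z"
  and bilin_scale_right: "bilin A e x (\<lambda>i. c * z i) = c * bilin A e x z"
  by (simp_all add: bilin_def algebra_simps sum.distrib sum_distrib_left)

lemma bilin_add_matrix: "bilin A (\<lambda>i j. e i j + e' i j) x z = bilin A e x z + bilin A e' x z"
  by (simp add: bilin_def algebra_simps sum.distrib)

lemma bilin_cong: "(\<And>i. i \<in> A \<Longrightarrow> x i = x' i) \<Longrightarrow> (\<And>i. i \<in> A \<Longrightarrow> z i = z' i) \<Longrightarrow> bilin A e x z = bilin A e x' z'"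
  by (simp add: bilin_def)

text \<open>Mesh h moves each coordinate by at most h, hence a vector by at most h sqrt n = 1/4.
  Since 16 n h^2 = 1, the unit ball corresponds to integer points of squared norm at most 16
  n.\<close>

lemma lattice_rounding:
  fixes x :: "'a \<Rightarrow> real"
  assumes A: "finite A" "A \<noteq> {}" and x: "L2_set x A \<le> 1" and h: "h = 1 / (4 * sqrt (card A))"
  obtains k where "k \<in> lattice_ball A (16 * card A)" "L2_set (\<lambda>i. h * of_int (k i)) A \<le> 1"
    "L2_set (\<lambda>i. x i - h * of_int (k i)) A \<le> 1 / 4"
proof -
  let ?n = "real (card A)"
  have n: "0 < ?n" using A by (simp add: card_gt_0_iff)
  have h_pos: "0 < h" using n by (simp add: h)
  have h2: "16 * ?n * h\<^sup>2 = 1" using n by (simp add: h power_divide power_mult_distrib)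
  \<comment> \<open>Truncation toward zero, rather than rounding to the nearest integer, never
    increases a coordinate, so the rounded vector stays in the unit ball.\<close>
  define tr where "tr r = (if 0 \<le> r then \<lfloor>r\<rfloor> else \<lceil>r\<rceil>)" for r :: real
  have tr: "\<bar>of_int (tr r)\<bar> \<le> \<bar>r\<bar>" "\<bar>r - of_int (tr r)\<bar> \<le> 1" for r
    unfolding tr_def by (auto split: if_splits; linarith)+
  define k where "k = (\<lambda>i\<in>A. tr (x i / h))"
  have hk: "\<bar>h * of_int (k i)\<bar> \<le> \<bar>x i\<bar>" if "i \<in> A" for i
    using mult_left_mono[OF tr(1)[of "x i / h"], of h] h_pos that by (simp add: k_def abs_mult)
  have hk': "\<bar>x i - h * of_int (k i)\<bar> \<le> h" if "i \<in> A" for i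
  proof -
    have "x i - h * of_int (k i) = h * (x i / h - of_int (tr (x i / h)))"
      using that h_pos by (simp add: k_def right_diff_distrib)
    then show ?thesis using mult_left_mono[OF tr(2)[of "x i / h"], of h] h_pos by (simp add: abs_mult)
  qed
  have norm_hk: "L2_set (\<lambda>i. h * of_int (k i)) A \<le> L2_set x A"
    unfolding L2_set_def by (intro real_sqrt_le_mono sum_mono) (use hk in \<open>simp add: abs_le_square_iff\<close>)
  then have le1: "L2_set (\<lambda>i. h * of_int (k i)) A \<le> 1" using x by linarith
  then have "(\<Sum>i\<in>A. (h * of_int (k i))\<^sup>2) \<le> 1" by (simp add: L2_set_def)
  then have "h\<^sup>2 * (\<Sum>i\<in>A. (of_int (k i))\<^sup>2) \<le> h\<^sup>2 * (16 * ?n)"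
    using h2 by (simp add: power_mult_distrib sum_distrib_left mult.commute)
  then have "(\<Sum>i\<in>A. (of_int (k i))\<^sup>2) \<le> 16 * ?n" using h_pos by simp
  then have "real_of_int (\<Sum>i\<in>A. (k i)\<^sup>2) \<le> real_of_int (int (16 * card A))" by simp
  then have sq: "(\<Sum>i\<in>A. (k i)\<^sup>2) \<le> int (16 * card A)" by (simp only: of_int_le_iff)
  have "\<bar>k i\<bar> \<le> int (16 * card A)" if "i \<in> A" for i
  proof -
    have "\<bar>k i\<bar> * 1 \<le> \<bar>k i\<bar> * \<bar>k i\<bar>"
      by (cases "k i = 0") (use mult_left_mono[of 1 "\<bar>k i\<bar>" "\<bar>k i\<bar>"] in auto)
    also have "\<dots> = (k i)\<^sup>2" by (simp add: power2_eq_square)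
    also have "\<dots> \<le> (\<Sum>i\<in>A. (k i)\<^sup>2)" using A that by (intro member_le_sum) auto
    finally show ?thesis using sq by simp
  qed
  then have ball: "k \<in> lattice_ball A (16 * card A)"
    using sq by (fastforce simp: lattice_ball_def k_def abs_le_iff PiE_iff)
  have "(\<Sum>i\<in>A. (x i - h * of_int (k i))\<^sup>2) \<le> (\<Sum>i\<in>A. h\<^sup>2)"
    using hk' h_pos by (intro sum_mono) (simp add: abs_le_square_iff[symmetric])
  also have "\<dots> = (1 / 4)\<^sup>2" using h2 by (simp add: power2_eq_square)
  finally have "L2_set (\<lambda>i. x i - h * of_int (k i)) A \<le> 1 / 4"
    unfolding L2_set_def by (rule real_le_lsqrt[rotated]) simp
  with ball le1 show ?thesis by (rule that)
qed

text \<open>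
  With \<open>C\<close> the supremum of the form over pairs of unit vectors, rounding both arguments to the lattice
  of mesh $1/(4\sqrt n)$ costs \<open>C / 4\<close> each, so \<open>C \<le> s + C / 2\<close>.
\<close>
lemma bilin_le_of_lattice:
  fixes s :: real
  assumes A: "finite A" "A \<noteq> {}"
    and net: "\<And>k k'. k \<in> lattice_ball A (16 * card A) \<Longrightarrow> k' \<in> lattice_ball A (16 * card A)
      \<Longrightarrow> bilin A e (\<lambda>i. of_int (k i)) (\<lambda>i. of_int (k' i)) \<le> 16 * card A * s"
  shows "\<bar>bilin A e x z\<bar> \<le> 2 * s * L2_set x A * L2_set z A"
proof -
  let ?n = "real (card A)"
  have n: "0 < ?n" using A by (simp add: card_gt_0_iff)
  define h where "h = 1 / (4 * sqrt ?n)"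
  have h2: "h * h * (16 * ?n) = 1" using n by (simp add: h_def)
  define U where "U = {x :: 'a \<Rightarrow> real. L2_set x A \<le> 1}"
  define C where "C = (SUP (x, z) \<in> U \<times> U. bilin A e x z)"
  have small: "\<bar>x i\<bar> \<le> 1" if "x \<in> U" "i \<in> A" for x i
  proof -
    have "\<bar>x i\<bar> \<le> L2_set x A" using member_le_L2_set[of A i "\<lambda>i. \<bar>x i\<bar>"] A that by (simp add: L2_set_def)
    then show ?thesis using that by (simp add: U_def)
  qed
  \<comment> \<open>Finiteness of the supremum C is what later permits subtracting C / 2 from both
    sides.\<close>
  have "bdd_above ((\<lambda>(x, z). bilin A e x z) ` (U \<times> U))"
  proof (rule bdd_aboveI2, clarify)
    fix x z assume xz: "x \<in> U" "z \<in> U"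
    have "bilin A e x z = (\<Sum>i\<in>A. \<Sum>j\<in>A. x i * (e i j * z j))"
      by (simp add: bilin_def sum_distrib_left)
    also have "\<dots> \<le> (\<Sum>i\<in>A. \<Sum>j\<in>A. \<bar>e i j\<bar>)"
    proof (intro sum_mono)
      fix i j assume ij: "i \<in> A" "j \<in> A"
      have "x i * (e i j * z j) \<le> \<bar>x i\<bar> * (\<bar>e i j\<bar> * \<bar>z j\<bar>)"
        by (metis abs_ge_self abs_mult)
      also have "\<dots> \<le> 1 * (\<bar>e i j\<bar> * 1)"
        using small xz ij by (intro mult_mono) auto
      finally show "x i * (e i j * z j) \<le> \<bar>e i j\<bar>" by simp
    qed
    finally show "bilin A e x z \<le> (\<Sum>i\<in>A. \<Sum>j\<in>A. \<bar>e i j\<bar>)" .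
  qed
  then have C: "bilin A e x z \<le> C" if "x \<in> U" "z \<in> U" for x z
    unfolding C_def using that cSUP_upper[of "(x, z)" "U \<times> U" "\<lambda>(x, z). bilin A e x z"] by simp
  have unit: "bilin A e x z \<le> s + C / 2" if xz: "x \<in> U" "z \<in> U" for x z
  proof -
    obtain k where k: "k \<in> lattice_ball A (16 * card A)" "L2_set (\<lambda>i. h * of_int (k i)) A \<le> 1"
      "L2_set (\<lambda>i. x i - h * of_int (k i)) A \<le> 1 / 4"
      using lattice_rounding[OF A _ h_def, of x] xz by (auto simp: U_def)
    obtain k' where k': "k' \<in> lattice_ball A (16 * card A)" "L2_set (\<lambda>i. h * of_int (k' i)) A \<le> 1"
      "L2_set (\<lambda>i. z i - h * of_int (k' i)) A \<le> 1 / 4"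
      using lattice_rounding[OF A _ h_def, of z] xz by (auto simp: U_def)
    let ?k = "\<lambda>i. h * of_int (k i)" and ?k' = "\<lambda>i. h * of_int (k' i)"
    have resc: "(\<lambda>i. 4 * (y i - l i)) \<in> U" if "L2_set (\<lambda>i. y i - l i) A \<le> 1 / 4" for y l :: "'a \<Rightarrow> real"
      unfolding U_def mem_Collect_eq
      using that L2_set_right_distrib[of 4 "\<lambda>i. y i - l i" A, OF zero_le_numeral] by linarith
    \<comment> \<open>Only the rounded part of x meets the rounding of z, which leaves three terms.
      Four times each remainder is again in the unit ball, so C bounds it.\<close>
    have "bilin A e x z = bilin A e (\<lambda>i. ?k i + (x i - ?k i)) z" by (rule bilin_cong) auto
    also have "\<dots> = bilin A e ?k (\<lambda>i. ?k' i + (z i - ?k' i)) + bilin A e (\<lambda>i. x i - ?k i) z"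
      unfolding bilin_add_left by (intro arg_cong2[where f = "(+)"] bilin_cong) auto
    also have "\<dots> = h * h * bilin A e (\<lambda>i. of_int (k i)) (\<lambda>i. of_int (k' i))
        + 1 / 4 * bilin A e ?k (\<lambda>i. 4 * (z i - ?k' i)) + 1 / 4 * bilin A e (\<lambda>i. 4 * (x i - ?k i)) z"
      by (simp only: bilin_add_right bilin_scale_left bilin_scale_right)
    also have "h * h * bilin A e (\<lambda>i. of_int (k i)) (\<lambda>i. of_int (k' i)) \<le> h * h * (16 * ?n * s)"
      using net[OF k(1) k'(1)] by (intro mult_left_mono) auto
    also have "h * h * (16 * ?n * s) = s" using h2 by (metis mult.assoc mult_1)
    also have "bilin A e ?k (\<lambda>i. 4 * (z i - ?k' i)) \<le> C"
      using k k' by (intro C resc) (simp_all add: U_def)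
    also have "bilin A e (\<lambda>i. 4 * (x i - ?k i)) z \<le> C"
      using k xz by (intro C resc)
    finally show ?thesis by simp
  qed
  have "(\<lambda>_. 0) \<in> U" by (simp add: U_def L2_set_def)
  then have "C \<le> s + C / 2"
    unfolding C_def using unit[unfolded C_def] by (intro cSUP_least) auto
  then have le: "bilin A e x z \<le> 2 * s" if "x \<in> U" "z \<in> U" for x z
    using C[OF that] by linarith
  have general: "bilin A e x z \<le> 2 * s * L2_set x A * L2_set z A" for x z
  proof (cases "L2_set x A = 0 \<or> L2_set z A = 0")
    case True
    then have "(\<forall>i\<in>A. x i = 0) \<or> (\<forall>i\<in>A. z i = 0)" using A by (simp add: L2_set_eq_0_iff)
    then have "bilin A e x z = 0" by (auto simp: bilin_def)
    then show ?thesis using True by auto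
  next
    case False
    define X Z where "X = L2_set x A" and "Z = L2_set z A"
    have XZ: "0 < X" "0 < Z" using False by (simp_all add: X_def Z_def order_less_le)
    have "(\<lambda>i. 1 / X * x i) \<in> U" "(\<lambda>i. 1 / Z * z i) \<in> U"
      using XZ by (simp_all only: U_def mem_Collect_eq L2_set_right_distrib[symmetric] zero_le_divide_1_iff less_imp_le)
        (simp_all add: X_def Z_def)
    from le[OF this] have "1 / X * (1 / Z * bilin A e x z) \<le> 2 * s"
      by (simp only: bilin_scale_left bilin_scale_right)
    then show ?thesis using XZ by (simp add: field_simps X_def[symmetric] Z_def[symmetric])
  qed
  \<comment> \<open>The absolute value comes from replacing x by its negative, which has the same
    norm.\<close>
  have "- bilin A e x z = bilin A e (\<lambda>i. (- 1) * x i) z" by (subst bilin_scale_left) simp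
  also have "\<dots> \<le> 2 * s * L2_set x A * L2_set z A"
    using general[of "\<lambda>i. (- 1) * x i" z] by (simp add: L2_set_def)
  finally show ?thesis using general[of x z] by linarith
qed

section \<open>Concentration in the comparison model\<close>

lemma finite_grid [simp]: "finite (grid T)"
  by (simp add: grid_def)

lemma nbhd_subset: "nbhd T \<delta> t \<subseteq> grid T"
  by (auto simp: nbhd_def)

lemma finite_nbhd [simp]: "finite (nbhd T \<delta> t)"
  using nbhd_subset finite_grid by (rule finite_subset)

lemma finite_nbhd_edge [simp]: "finite (nbhd_edge T E \<delta> t i j)"
  by (simp add: nbhd_edge_def)

lemma grid_unit: "s \<in> grid T \<Longrightarrow> 0 \<le> s \<and> s \<le> 1"
  by (auto simp: grid_def divide_le_eq_1)

lemma nbhd_edge_commute: "nbhd_edge T E \<delta> t j i = nbhd_edge T E \<delta> t i j"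
  by (simp add: nbhd_edge_def insert_commute)

lemma y_star_commute:
  assumes "positive_scores n w" "i \<in> {1..n}" "j \<in> {1..n}" "0 \<le> s" "s \<le> 1"
  shows "y_star w s j i = 1 - y_star w s i j"
proof -
  have "0 < w s i" "0 < w s j" using assms by (simp_all add: positive_scores_def)
  then show ?thesis by (simp add: y_star_def field_simps)
qed

lemma y_star_bounds:
  assumes "positive_scores n w" "i \<in> {1..n}" "j \<in> {1..n}" "0 \<le> s" "s \<le> 1"
  shows "0 \<le> y_star w s i j \<and> y_star w s i j \<le> 1"
proof -
  have "0 < w s i" "0 < w s j" using assms by (simp_all add: positive_scores_def)
  then show ?thesis by (simp add: y_star_def)
qed

text \<open>The centered part of the empirical winning rate, given the graphs. On the diagonal
  \<open>y_obs\<close> has no meaning; 0 is the value compatible with antisymmetry. A pair that is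
  never compared also gets 0, through division by zero.\<close>

definition noise ::
    "nat \<Rightarrow> nat \<Rightarrow> (real \<Rightarrow> nat \<Rightarrow> real) \<Rightarrow> real \<Rightarrow> real \<Rightarrow> graphs \<Rightarrow> outcomes \<Rightarrow> matrix" where
  "noise T L w \<delta> t E Y i j =
     (if i = j then 0
      else (\<Sum>s\<in>nbhd_edge T E \<delta> t i j. \<Sum>l\<in>{1..L}. y_obs Y l s i j - y_star w s i j)
             / (real L * real (card (nbhd_edge T E \<delta> t i j))))"

lemma noise_antisym:
  assumes "positive_scores n w" "i \<in> {1..n}" "j \<in> {1..n}"
  shows "noise T L w \<delta> t E Y j i = - noise T L w \<delta> t E Y i j"
proof (cases "i = j")
  case False
  have "y_obs Y l s j i - y_star w s j i = - (y_obs Y l s i j - y_star w s i j)"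
    if "s \<in> nbhd_edge T E \<delta> t i j" for l s
  proof -
    have "s \<in> grid T" using that nbhd_subset by (auto simp: nbhd_edge_def)
    from grid_unit[OF this] show ?thesis
      using False y_star_commute[OF assms, of s] by (auto simp: y_obs_def)
  qed
  then have "(\<Sum>s\<in>nbhd_edge T E \<delta> t i j. \<Sum>l\<in>{1..L}. y_obs Y l s j i - y_star w s j i)
      = (\<Sum>s\<in>nbhd_edge T E \<delta> t i j. \<Sum>l\<in>{1..L}. - (y_obs Y l s i j - y_star w s i j))"
    by (intro sum.cong refl)
  also have "\<dots> = - (\<Sum>s\<in>nbhd_edge T E \<delta> t i j. \<Sum>l\<in>{1..L}. y_obs Y l s i j - y_star w s i j)"
    by (simp only: sum_negf)
  finally show ?thesis using False
    by (simp only: noise_def nbhd_edge_commute[of T E \<delta> t j i] minus_divide_left if_False) simp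
qed (simp add: noise_def)

text \<open>Moving the pair to the front of the tuple lets a sum over comparisons be grouped by
  pairs.\<close>

lemma comparisons_eq:
  "comparisons n T L E = (\<lambda>(i, j, s, l). (s, i, j, l)) `
     (SIGMA i:{1..n}. SIGMA j:{i<..n}. SIGMA s:{s \<in> grid T. {i, j} \<in> E s}. {1..L})"
  by (force simp: comparisons_def image_iff)

lemma finite_comparisons: "finite (comparisons n T L E)"
  by (simp add: comparisons_eq finite_SigmaI)

lemma sum_comparisons:
  "(\<Sum>k\<in>comparisons n T L E. g k)
    = (\<Sum>i\<in>{1..n}. \<Sum>j\<in>{i<..n}. \<Sum>s\<in>{s \<in> grid T. {i, j} \<in> E s}. \<Sum>l\<in>{1..L}. g (s, i, j, l) :: real)"
proof -
  have "(\<Sum>k\<in>comparisons n T L E. g k) = (\<Sum>(i, j, s, l)\<in>(SIGMA i:{1..n}. SIGMA j:{i<..n}. SIGMA s:{s \<in> grid T. {i, j} \<in> E s}. {1..L}). g (s, i, j, l))"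
    unfolding comparisons_eq by (subst sum.reindex) (auto intro!: inj_onI sum.cong)
  then show ?thesis by (simp add: sum.Sigma finite_SigmaI)
qed

text \<open>Entries (i, j) and (j, i) carry the same randomness with opposite signs. Combining them
  expresses the form in the independent entries above the diagonal.\<close>

lemma bilin_antisym:
  fixes e :: matrix
  assumes "\<And>i j. i \<in> {1..n} \<Longrightarrow> j \<in> {1..n} \<Longrightarrow> e j i = - e i j"
  shows "bilin {1..n} e x z = (\<Sum>i\<in>{1..n}. \<Sum>j\<in>{i<..n}. (x i * z j - x j * z i) * e i j)"
proof -
  have "bilin {1..n} e x z = (\<Sum>i\<in>{1..n}. \<Sum>j\<in>{1..n}. x i * e i j * z j)"
    by (simp add: bilin_def sum_distrib_left mult.assoc)
  also have "\<dots> = (\<Sum>i\<in>{1..n}. \<Sum>j\<in>{i<..n}. x i * e i j * z j + x j * e j i * z i) + (\<Sum>i\<in>{1..n}. x i * e i i * z i)"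
    by (rule sum_square_split[of "\<lambda>i j. x i * e i j * z j"])
  also have "(\<Sum>i\<in>{1..n}. x i * e i i * z i) = 0"
  proof (rule sum.neutral, clarify)
    fix i assume "i \<in> {1..n}"
    then have "e i i = 0" using assms[of i i] by linarith
    then show "x i * e i i * z i = 0" by simp
  qed
  also have "(\<Sum>i\<in>{1..n}. \<Sum>j\<in>{i<..n}. x i * e i j * z j + x j * e j i * z i)
      = (\<Sum>i\<in>{1..n}. \<Sum>j\<in>{i<..n}. (x i * z j - x j * z i) * e i j)"
  proof (intro sum.cong refl)
    fix i j assume "i \<in> {1..n}" "j \<in> {i<..n}"
    then have "e j i = - e i j" using assms[of i j] by auto
    then show "x i * e i j * z j + x j * e j i * z i = (x i * z j - x j * z i) * e i j"
      by (simp add: algebra_simps)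
  qed
  finally show ?thesis by simp
qed

text \<open>Hoeffding's inequality conditional on the graphs. A pair compared at m times enters
  through m L variables, whose squared coefficients add up to (x_i z_j - x_j z_i)^2 / (L m). The
  normalization \<epsilon>^2 = 1 / (2 L \<nu>) cancels the factor 2 in Hoeffding's exponent.\<close>

lemma noise_tail:
  assumes w: "positive_scores n w" and L: "1 \<le> L" and \<nu>: "0 < \<nu>"
    and N: "\<And>i j. i \<in> {1..n} \<Longrightarrow> j \<in> {i<..n} \<Longrightarrow> \<nu> \<le> real (card (nbhd_edge T E \<delta> t i j))"
    and \<epsilon>: "2 * real L * \<nu> * \<epsilon>\<^sup>2 = 1"
    and X: "(\<Sum>i\<in>{1..n}. (x i)\<^sup>2) \<le> X" and Z: "(\<Sum>i\<in>{1..n}. (z i)\<^sup>2) \<le> Z" and s: "0 < s"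
  shows "measure_pmf.prob (random_outcomes n T L w E)
      {Y. s \<le> bilin {1..n} (noise T L w \<delta> t E Y) x z} \<le> exp (- s\<^sup>2 / (X * Z * \<epsilon>\<^sup>2))"
proof -
  let ?N = "nbhd_edge T E \<delta> t"
  define q where "q = (\<lambda>(s, i, j, l :: nat). y_star w s i j)"
  \<comment> \<open>Comparisons range over the whole grid; those outside the neighborhood receive
    coefficient 0.\<close>
  define c where "c = (\<lambda>(s, i, j, l :: nat). if s \<in> nbhd T \<delta> t
    then (x i * z j - x j * z i) / (real L * real (card (?N i j))) else 0)"
  have restrict: "(\<Sum>s\<in>{s \<in> grid T. {i, j} \<in> E s}. if s \<in> nbhd T \<delta> t then g s else 0) = (\<Sum>s\<in>?N i j. g s)"
    for i j and g :: "real \<Rightarrow> real"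
    using nbhd_subset by (intro sum.mono_neutral_cong_right) (auto simp: nbhd_edge_def)
  have form: "bilin {1..n} (noise T L w \<delta> t E Y) x z
      = (\<Sum>k\<in>comparisons n T L E. c k * (of_bool (Y k) - q k))" for Y
  proof -
    have "(\<Sum>s\<in>{s \<in> grid T. {i, j} \<in> E s}. \<Sum>l\<in>{1..L}. c (s, i, j, l) * (of_bool (Y (s, i, j, l)) - q (s, i, j, l)))
        = (x i * z j - x j * z i) * noise T L w \<delta> t E Y i j" if "j \<in> {i<..n}" for i j
    proof -
      have "(\<Sum>s\<in>{s \<in> grid T. {i, j} \<in> E s}. \<Sum>l\<in>{1..L}. c (s, i, j, l) * (of_bool (Y (s, i, j, l)) - q (s, i, j, l)))
        = (\<Sum>s\<in>{s \<in> grid T. {i, j} \<in> E s}. if s \<in> nbhd T \<delta> t then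
            \<Sum>l\<in>{1..L}. (x i * z j - x j * z i) / (real L * real (card (?N i j))) * (y_obs Y l s i j - y_star w s i j) else 0)"
        using that by (intro sum.cong refl) (auto simp: c_def q_def y_obs_def)
      then show ?thesis
        using that unfolding restrict by (simp add: noise_def sum_distrib_left sum_divide_distrib)
    qed
    then show ?thesis
      unfolding sum_comparisons by (subst bilin_antisym[OF noise_antisym[OF w]]) (auto intro!: sum.cong)
  qed
  have scale: "m * (l * (D / (l * m))\<^sup>2) = D\<^sup>2 * (1 / (l * m))" if "0 < m" "0 < l" for m l D :: real
    using that by (simp add: power_divide power2_eq_square)
  have var: "(\<Sum>k\<in>comparisons n T L E. (c k)\<^sup>2) \<le> 2 * (X * Z * \<epsilon>\<^sup>2)"
  proof -
    have "(\<Sum>s\<in>{s \<in> grid T. {i, j} \<in> E s}. \<Sum>l\<in>{1..L}. (c (s, i, j, l))\<^sup>2) \<le> (x i * z j - x j * z i)\<^sup>2 * (2 * \<epsilon>\<^sup>2)"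
      if ij: "i \<in> {1..n}" "j \<in> {i<..n}" for i j
    proof -
      let ?m = "real (card (?N i j))"
      have m: "\<nu> \<le> ?m" "0 < ?m" using N[OF ij] \<nu> by linarith+
      have "(\<Sum>s\<in>{s \<in> grid T. {i, j} \<in> E s}. \<Sum>l\<in>{1..L}. (c (s, i, j, l))\<^sup>2)
        = (\<Sum>s\<in>{s \<in> grid T. {i, j} \<in> E s}. if s \<in> nbhd T \<delta> t then
            real L * ((x i * z j - x j * z i) / (real L * ?m))\<^sup>2 else 0)"
        by (intro sum.cong refl) (simp add: c_def)
      also have "\<dots> = ?m * (real L * ((x i * z j - x j * z i) / (real L * ?m))\<^sup>2)"
        unfolding restrict by simp
      also have "\<dots> = (x i * z j - x j * z i)\<^sup>2 * (1 / (real L * ?m))"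
        using m L by (intro scale) auto
      also have "\<dots> \<le> (x i * z j - x j * z i)\<^sup>2 * (1 / (real L * \<nu>))"
        using m \<nu> L by (intro mult_left_mono divide_left_mono) auto
      also have "1 / (real L * \<nu>) = 2 * \<epsilon>\<^sup>2" using \<epsilon> \<nu> L by (simp add: field_simps)
      finally show ?thesis .
    qed
    then have "(\<Sum>k\<in>comparisons n T L E. (c k)\<^sup>2)
        \<le> (\<Sum>i\<in>{1..n}. \<Sum>j\<in>{i<..n}. (x i * z j - x j * z i)\<^sup>2 * (2 * \<epsilon>\<^sup>2))"
      unfolding sum_comparisons by (intro sum_mono) auto
    also have "\<dots> = (\<Sum>i\<in>{1..n}. \<Sum>j\<in>{i<..n}. (x i * z j - x j * z i)\<^sup>2) * (2 * \<epsilon>\<^sup>2)"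
      by (simp only: sum_distrib_right)
    also have "\<dots> \<le> (X * Z) * (2 * \<epsilon>\<^sup>2)"
      using X Z sum_nonneg[of "{1..n}" "\<lambda>i. (x i)\<^sup>2"] sum_nonneg[of "{1..n}" "\<lambda>i. (z i)\<^sup>2"]
      by (intro mult_right_mono order_trans[OF Lagrange_identity_le] mult_mono) auto
    finally show ?thesis by simp
  qed
  have q: "0 \<le> q k \<and> q k \<le> 1" if "k \<in> comparisons n T L E" for k
    using that y_star_bounds[OF w] grid_unit by (auto simp: comparisons_def q_def)
  have "random_outcomes n T L w E = Pi_pmf (comparisons n T L E) False (\<lambda>k. bernoulli_pmf (q k))"
    unfolding random_outcomes_def q_def by (intro Pi_pmf_cong) auto
  then show ?thesis
    using Hoeffding_bernoulli[OF finite_comparisons q var s] unfolding form by simp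
qed

lemma prob_Union_le:
  fixes c :: real
  assumes "finite I" "\<And>i. i \<in> I \<Longrightarrow> measure_pmf.prob M (B i) \<le> c" "S \<subseteq> (\<Union>i\<in>I. B i)"
  shows "measure_pmf.prob M S \<le> card I * c"
proof -
  have "measure_pmf.prob M S \<le> measure_pmf.prob M (\<Union>i\<in>I. B i)"
    using assms by (intro measure_pmf.finite_measure_mono) auto
  also have "\<dots> \<le> (\<Sum>i\<in>I. measure_pmf.prob M (B i))"
    using assms by (intro measure_pmf.finite_measure_subadditive_finite) auto
  also have "\<dots> \<le> card I * c" using assms(2) by (rule sum_bounded_above)
  finally show ?thesis .
qed

context
  fixes n T L :: nat and w :: "real \<Rightarrow> nat \<Rightarrow> real" and E :: graphs and \<delta> t \<nu> \<epsilon> :: real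
  assumes n: "2 \<le> n" and w: "positive_scores n w" and L: "1 \<le> L" and \<nu>: "0 < \<nu>"
    and N: "\<And>i j. i \<in> {1..n} \<Longrightarrow> j \<in> {i<..n} \<Longrightarrow> \<nu> \<le> real (card (nbhd_edge T E \<delta> t i j))"
    and \<epsilon>: "2 * real L * \<nu> * \<epsilon>\<^sup>2 = 1" and \<epsilon>_pos: "0 < \<epsilon>"
begin

text \<open>A row is the form at a unit vector, so X = 1 and Z = n, and the threshold makes the
  exponent 10 log n. The union runs over n rows and two signs. The vector z must be fixed before the
  outcomes are drawn.\<close>

lemma noise_row_concentration:
  assumes z: "\<And>i. i \<in> {1..n} \<Longrightarrow> \<bar>z i\<bar> \<le> 1"
  shows "measure_pmf.prob (random_outcomes n T L w E)
      {Y. \<exists>i\<in>{1..n}. sqrt (10 * real n * ln n) * \<epsilon> < \<bar>\<Sum>j\<in>{1..n}. noise T L w \<delta> t E Y i j * z j\<bar>}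
    \<le> 2 * real n * exp (- 10 * ln n)"
proof -
  let ?s = "sqrt (10 * real n * ln n) * \<epsilon>"
  let ?x = "\<lambda>(i, c) k. if k = i then c else 0 :: real"
  have s: "0 < ?s" using n \<epsilon>_pos by simp
  have Z: "(\<Sum>i\<in>{1..n}. (z i)\<^sup>2) \<le> n"
    using sum_mono[of "{1..n}" "\<lambda>i. (z i)\<^sup>2" "\<lambda>_. 1"] z by (simp add: abs_square_le_1)
  have bil: "bilin {1..n} e (?x (i, c)) z = c * (\<Sum>j\<in>{1..n}. e i j * z j)" if "i \<in> {1..n}" for e i c
    using that by (simp add: bilin_def if_distrib[of "\<lambda>x. x * _"] cong: if_cong)
  have "measure_pmf.prob (random_outcomes n T L w E)
      {Y. \<exists>i\<in>{1..n}. ?s < \<bar>\<Sum>j\<in>{1..n}. noise T L w \<delta> t E Y i j * z j\<bar>}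
    \<le> card ({1..n} \<times> {1, - 1 :: real}) * exp (- 10 * ln n)"
  proof (rule prob_Union_le[where B = "\<lambda>p. {Y. ?s \<le> bilin {1..n} (noise T L w \<delta> t E Y) (?x p) z}"])
    fix p assume p: "p \<in> {1..n} \<times> {1, - 1 :: real}"
    then have X: "(\<Sum>k\<in>{1..n}. (?x p k)\<^sup>2) \<le> 1"
      by (auto simp: if_distrib[of "\<lambda>x. x\<^sup>2"] cong: if_cong)
    have "- ?s\<^sup>2 / (1 * real n * \<epsilon>\<^sup>2) = - 10 * ln n"
      using n \<epsilon>_pos by (simp add: power_mult_distrib)
    then show "measure_pmf.prob (random_outcomes n T L w E)
        {Y. ?s \<le> bilin {1..n} (noise T L w \<delta> t E Y) (?x p) z} \<le> exp (- 10 * ln n)"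
      using noise_tail[OF w L \<nu> N \<epsilon> X Z s] by simp
  next
    show "{Y. \<exists>i\<in>{1..n}. ?s < \<bar>\<Sum>j\<in>{1..n}. noise T L w \<delta> t E Y i j * z j\<bar>}
      \<subseteq> (\<Union>p\<in>{1..n} \<times> {1, - 1}. {Y. ?s \<le> bilin {1..n} (noise T L w \<delta> t E Y) (?x p) z})"
    proof clarify
      fix Y i assume i: "i \<in> {1..n}" and Y: "?s < \<bar>\<Sum>j\<in>{1..n}. noise T L w \<delta> t E Y i j * z j\<bar>"
      define c :: real where "c = (if 0 \<le> (\<Sum>j\<in>{1..n}. noise T L w \<delta> t E Y i j * z j) then 1 else - 1)"
      have "?s \<le> bilin {1..n} (noise T L w \<delta> t E Y) (?x (i, c)) z"
        using Y unfolding bil[OF i] by (auto simp: c_def)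
      moreover have "(i, c) \<in> {1..n} \<times> {1, - 1}" using i by (auto simp: c_def)
      ultimately show "Y \<in> (\<Union>p\<in>{1..n} \<times> {1, - 1}. {Y. ?s \<le> bilin {1..n} (noise T L w \<delta> t E Y) (?x p) z})"
        by blast
    qed
  qed auto
  then show ?thesis by (simp add: card_cartesian_product mult.commute)
qed

text \<open>The pairs of net points number at most exp(36 n), and each has tail exp(- 49 n), because
  lattice vectors have squared norm at most 16 n and 49 = 7^2. Passing from the net to all vectors
  doubles 7 to 14.\<close>

lemma noise_operator_concentration:
  "measure_pmf.prob (random_outcomes n T L w E)
      {Y. \<not> (\<forall>x z. \<bar>bilin {1..n} (noise T L w \<delta> t E Y) x z\<bar>
             \<le> 14 * sqrt n * \<epsilon> * L2_set x {1..n} * L2_set z {1..n})}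
    \<le> exp (- 13 * real n)"
proof -
  let ?s = "7 * sqrt n * \<epsilon>"
  let ?B = "lattice_ball {1..n} (16 * n)"
  let ?b = "\<lambda>Y (k, k'). bilin {1..n} (noise T L w \<delta> t E Y) (\<lambda>i. of_int (k i)) (\<lambda>i. of_int (k' i))"
  have s: "0 < 16 * real n * ?s" using n \<epsilon>_pos by simp
  have two_s: "2 * ?s = 14 * sqrt n * \<epsilon>" by simp
  have finB: "finite ?B" by (rule finite_lattice_ball) simp
  have "measure_pmf.prob (random_outcomes n T L w E)
      {Y. \<not> (\<forall>x z. \<bar>bilin {1..n} (noise T L w \<delta> t E Y) x z\<bar>
             \<le> 14 * sqrt n * \<epsilon> * L2_set x {1..n} * L2_set z {1..n})}
    \<le> card (?B \<times> ?B) * exp (- 49 * real n)"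
  proof (rule prob_Union_le[where B = "\<lambda>p. {Y. 16 * real n * ?s \<le> ?b Y p}"])
    fix p assume "p \<in> ?B \<times> ?B"
    then obtain k k' where p: "p = (k, k')" "k \<in> ?B" "k' \<in> ?B" by blast
    have norm: "(\<Sum>i\<in>{1..n}. (real_of_int (k i))\<^sup>2) \<le> 16 * real n" if "k \<in> ?B" for k
    proof -
      have "real_of_int (\<Sum>i\<in>{1..n}. (k i)\<^sup>2) \<le> real_of_int (int (16 * n))"
        using that by (simp only: of_int_le_iff) (simp add: lattice_ball_def)
      then show ?thesis by simp
    qed
    have "- (16 * real n * ?s)\<^sup>2 / (16 * real n * (16 * real n) * \<epsilon>\<^sup>2) = - 49 * real n"
      using n \<epsilon>_pos by (simp add: power_mult_distrib power2_eq_square)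
    then show "measure_pmf.prob (random_outcomes n T L w E) {Y. 16 * real n * ?s \<le> ?b Y p} \<le> exp (- 49 * real n)"
      using noise_tail[OF w L \<nu> N \<epsilon> norm[OF p(2)] norm[OF p(3)] s] by (simp add: p)
  next
    show "{Y. \<not> (\<forall>x z. \<bar>bilin {1..n} (noise T L w \<delta> t E Y) x z\<bar>
             \<le> 14 * sqrt n * \<epsilon> * L2_set x {1..n} * L2_set z {1..n})}
      \<subseteq> (\<Union>p\<in>?B \<times> ?B. {Y. 16 * real n * ?s \<le> ?b Y p})"
    proof (rule subsetI, rule ccontr)
      fix Y assume Y: "Y \<in> {Y. \<not> (\<forall>x z. \<bar>bilin {1..n} (noise T L w \<delta> t E Y) x z\<bar>
             \<le> 14 * sqrt n * \<epsilon> * L2_set x {1..n} * L2_set z {1..n})}"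
        and neg: "Y \<notin> (\<Union>p\<in>?B \<times> ?B. {Y. 16 * real n * ?s \<le> ?b Y p})"
      have "\<bar>bilin {1..n} (noise T L w \<delta> t E Y) x z\<bar> \<le> 2 * ?s * L2_set x {1..n} * L2_set z {1..n}" for x z
      proof (rule bilin_le_of_lattice)
        fix k k' assume "k \<in> lattice_ball {1..n} (16 * card {1..n})" "k' \<in> lattice_ball {1..n} (16 * card {1..n})"
        then have "\<not> 16 * real n * ?s \<le> ?b Y (k, k')" using neg by auto
        then show "bilin {1..n} (noise T L w \<delta> t E Y) (\<lambda>i. of_int (k i)) (\<lambda>i. of_int (k' i)) \<le> 16 * card {1..n} * ?s"
          by simp
      qed (use n in auto)
      from this[unfolded two_s] Y show False by blast
    qed
  qed (use finB in auto)
  also have "card (?B \<times> ?B) * exp (- 49 * real n) \<le> (exp (18 * real n) * exp (18 * real n)) * exp (- 49 * real n)"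
  proof (rule mult_right_mono)
    \<comment> \<open>The exponent is 16 n from the squared radius plus 2 n from the
      dimension.\<close>
    have "real (card ?B) \<le> exp (18 * real n)"
      using card_lattice_ball[of "{1..n}" "16 * n"] by simp
    then show "real (card (?B \<times> ?B)) \<le> exp (18 * real n) * exp (18 * real n)"
      unfolding card_cartesian_product of_nat_mult by (intro mult_mono) auto
  qed simp
  also have "\<dots> = exp (- 13 * real n)" by (simp add: exp_add[symmetric])
  finally show ?thesis .
qed

end

section \<open>Edge counts in the random graphs\<close>

lemma finite_pairs [simp]: "finite (pairs n)"
  unfolding pairs_def by (rule finite_subset[of _ "Pow {1..n}"]) auto

lemma erdos_renyi_edge:
  assumes "e \<in> pairs n"
  shows "map_pmf (\<lambda>G. e \<in> G) (erdos_renyi n q) = bernoulli_pmf q"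
  using assms by (simp add: erdos_renyi_def pmf.map_comp o_def Pi_pmf_component)

text \<open>Chernoff's lower tail with Laplace parameter 1. From exp(-1) \<le> 2/5, each time
  contributes a factor at most exp(- 3 p / 5). Markov's inequality at level exp(- P / 2) leaves 3/5
  - 1/2 = 1/10 in the exponent.\<close>

lemma edge_count_tail:
  assumes e: "e \<in> pairs n" and p: "\<And>s. s \<in> grid T \<Longrightarrow> 0 \<le> p s \<and> p s \<le> 1"
  shows "measure_pmf.prob (random_graphs n T p)
      {E. real (card {s \<in> nbhd T \<delta> t. e \<in> E s}) \<le> p_sum T p \<delta> t / 2} \<le> exp (- p_sum T p \<delta> t / 10)"
proof -
  let ?P = "p_sum T p \<delta> t"
  \<comment> \<open>The exponential of minus the count is written as a product with one factor per
    independent graph; times outside the neighborhood contribute 1.\<close>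
  define f where "f s G = (if s \<in> nbhd T \<delta> t \<and> e \<in> G then exp (- 1) else 1 :: real)" for s and G :: "nat set set"
  have f: "(\<Prod>s\<in>grid T. f s (E s)) = exp (- real (card {s \<in> nbhd T \<delta> t. e \<in> E s}))" for E
  proof -
    have "(\<Prod>s\<in>grid T. f s (E s)) = (\<Prod>s\<in>{s \<in> nbhd T \<delta> t. e \<in> E s}. exp (- 1))"
      using nbhd_subset by (intro prod.mono_neutral_cong_right) (auto simp: f_def)
    then show ?thesis by (simp add: exp_of_nat_mult[symmetric])
  qed
  have int_f: "integrable (measure_pmf (erdos_renyi n (p s))) (f s)" for s
    by (intro measure_pmf.integrable_const_bound[where B = 1]) (auto simp: f_def)
  have Ef: "measure_pmf.expectation (erdos_renyi n (p s)) (f s)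
      \<le> (if s \<in> nbhd T \<delta> t then exp (- (3 / 5) * p s) else 1)" if s: "s \<in> grid T" for s
  proof (cases "s \<in> nbhd T \<delta> t")
    case True
    have "f s = (\<lambda>b. if b then exp (- 1) else 1) \<circ> (\<lambda>G. e \<in> G)"
      using True by (auto simp: f_def fun_eq_iff)
    then have "measure_pmf.expectation (erdos_renyi n (p s)) (f s)
        = measure_pmf.expectation (map_pmf (\<lambda>G. e \<in> G) (erdos_renyi n (p s))) (\<lambda>b. if b then exp (- 1) else 1)"
      by (simp add: o_def)
    also have "\<dots> = p s * exp (- 1) + (1 - p s)"
      using p[OF s] by (simp add: erdos_renyi_edge[OF e])
    also have "\<dots> \<le> 1 + - (3 / 5) * p s"
    proof -
      have "5 / 2 \<le> exp (1 :: real)" using exp_lower_Taylor_quadratic[of 1] by simp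
      then have "exp (- 1) \<le> 2 / (5 :: real)" by (simp add: exp_minus field_simps)
      from mult_left_mono[OF this, of "p s"] show ?thesis using p[OF s] by simp
    qed
    also have "\<dots> \<le> exp (- (3 / 5) * p s)" by (rule exp_ge_add_one_self)
    finally show ?thesis using True by simp
  next
    case False
    then have "f s = (\<lambda>_. 1)" by (simp add: f_def fun_eq_iff)
    then show ?thesis using False by simp
  qed
  have "measure_pmf.expectation (random_graphs n T p) (\<lambda>E. \<Prod>s\<in>grid T. f s (E s))
      = (\<Prod>s\<in>grid T. measure_pmf.expectation (erdos_renyi n (p s)) (f s))"
    unfolding random_graphs_def by (rule expectation_prod_Pi_pmf) (auto simp: int_f, simp add: f_def)
  also have "\<dots> \<le> (\<Prod>s\<in>grid T. if s \<in> nbhd T \<delta> t then exp (- (3 / 5) * p s) else 1)"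
    using Ef by (intro prod_mono) (auto simp: f_def intro!: integral_nonneg)
  also have "\<dots> = (\<Prod>s\<in>nbhd T \<delta> t. exp (- (3 / 5) * p s))"
    using nbhd_subset by (intro prod.mono_neutral_cong_right) auto
  also have "\<dots> = exp (- (3 / 5) * ?P)"
    by (simp add: exp_sum[symmetric] p_sum_def sum_distrib_left)
  finally have mean: "measure_pmf.expectation (random_graphs n T p) (\<lambda>E. \<Prod>s\<in>grid T. f s (E s)) \<le> exp (- (3 / 5) * ?P)" .
  have "{E. real (card {s \<in> nbhd T \<delta> t. e \<in> E s}) \<le> ?P / 2} = {E \<in> space (measure_pmf (random_graphs n T p)). exp (- ?P / 2) \<le> (\<Prod>s\<in>grid T. f s (E s))}"
    by (auto simp: f)
  also have "measure_pmf.prob (random_graphs n T p) \<dots>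
      \<le> measure_pmf.expectation (random_graphs n T p) (\<lambda>E. \<Prod>s\<in>grid T. f s (E s)) / exp (- ?P / 2)"
  proof (rule integral_Markov_inequality_measure[where A = UNIV])
    show "integrable (random_graphs n T p) (\<lambda>E. \<Prod>s\<in>grid T. f s (E s))"
      unfolding random_graphs_def by (intro integrable_prod_Pi_pmf finite_grid int_f)
    show "AE E in random_graphs n T p. 0 \<le> (\<Prod>s\<in>grid T. f s (E s))"
      by (intro AE_I2 prod_nonneg) (simp add: f_def)
  qed simp_all
  also have "\<dots> \<le> exp (- (3 / 5) * ?P) / exp (- ?P / 2)"
    using mean by (rule divide_right_mono) simp
  also have "\<dots> = exp (- ?P / 10)" by (subst exp_diff[symmetric]) simp
  finally show ?thesis .
qed

lemma edge_counts_tail: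
  assumes p: "\<And>s. s \<in> grid T \<Longrightarrow> 0 \<le> p s \<and> p s \<le> 1"
  shows "measure_pmf.prob (random_graphs n T p)
      {E. \<exists>i\<in>{1..n}. \<exists>j\<in>{i<..n}. card (nbhd_edge T E \<delta> t i j) \<le> p_sum T p \<delta> t / 2}
    \<le> (real n)\<^sup>2 * exp (- p_sum T p \<delta> t / 10)"
proof -
  have "measure_pmf.prob (random_graphs n T p)
      {E. \<exists>i\<in>{1..n}. \<exists>j\<in>{i<..n}. card (nbhd_edge T E \<delta> t i j) \<le> p_sum T p \<delta> t / 2}
    \<le> card (SIGMA i:{1..n}. {i<..n}) * exp (- p_sum T p \<delta> t / 10)"
  proof (rule prob_Union_le[where B = "\<lambda>(i, j). {E. card (nbhd_edge T E \<delta> t i j) \<le> p_sum T p \<delta> t / 2}"])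
    fix ij assume "ij \<in> (SIGMA i:{1..n}. {i<..n})"
    then obtain i j where ij: "ij = (i, j)" "i \<in> {1..n}" "j \<in> {i<..n}" by blast
    then have "{i, j} \<in> pairs n" by (auto simp: pairs_def)
    from edge_count_tail[OF this p] show "measure_pmf.prob (random_graphs n T p)
        (case ij of (i, j) \<Rightarrow> {E. card (nbhd_edge T E \<delta> t i j) \<le> p_sum T p \<delta> t / 2}) \<le> exp (- p_sum T p \<delta> t / 10)"
      by (simp add: ij nbhd_edge_def)
  qed auto
  also have "\<dots> \<le> (real n)\<^sup>2 * exp (- p_sum T p \<delta> t / 10)"
  proof (rule mult_right_mono)
    have "card (SIGMA i:{1..n}. {i<..n}) \<le> card ({1..n} \<times> {1..n})" by (rule card_mono) auto
    also have "\<dots> = n * n" by simp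
    finally have "card (SIGMA i:{1..n}. {i<..n}) \<le> n * n" .
    then show "real (card (SIGMA i:{1..n}. {i<..n})) \<le> (real n)\<^sup>2"
      unfolding power2_eq_square of_nat_mult[symmetric] of_nat_le_iff .
  qed simp
  finally show ?thesis .
qed

text \<open>Averaging the conditional success probability over \<open>G\<close> makes the failure
  probabilities of the two stages add up. It joins the randomness of graphs and outcomes.\<close>

lemma prob_bind_ge:
  assumes G: "1 - a \<le> measure_pmf.prob M G" and "0 \<le> b"
    and "\<And>x. x \<in> G \<Longrightarrow> 1 - b \<le> measure_pmf.prob (f x) S"
  shows "1 - (a + b) \<le> measure_pmf.prob (bind_pmf M f) S"
proof -
  have "measure_pmf.prob (bind_pmf M f) S = measure_pmf.expectation M (\<lambda>x. measure_pmf.prob (f x) S)"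
  proof -
    have "ennreal (measure_pmf.prob (bind_pmf M f) S) = (\<integral>\<^sup>+x. ennreal (measure_pmf.prob (f x) S) \<partial>M)"
      by (simp add: measure_pmf.emeasure_eq_measure[symmetric])
    also have "\<dots> = ennreal (measure_pmf.expectation M (\<lambda>x. measure_pmf.prob (f x) S))"
      by (intro nn_integral_eq_integral measure_pmf.integrable_const_bound[where B = 1]) auto
    finally show ?thesis by (simp add: integral_nonneg)
  qed
  moreover have "(1 - b) * measure_pmf.prob M G \<le> measure_pmf.expectation M (\<lambda>x. measure_pmf.prob (f x) S)"
  proof -
    have "(1 - b) * measure_pmf.prob M G = measure_pmf.expectation M (\<lambda>x. (1 - b) * indicator G x)" by simp
    also have "\<dots> \<le> measure_pmf.expectation M (\<lambda>x. measure_pmf.prob (f x) S)"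
      using assms(3) by (intro integral_mono measure_pmf.integrable_const_bound[where B = 1]
          integrable_mult_right) (auto simp: indicator_def)
    finally show ?thesis .
  qed
  moreover have "measure_pmf.prob M G - b \<le> (1 - b) * measure_pmf.prob M G"
    using mult_left_mono[OF measure_pmf.prob_le_1[of M G] \<open>0 \<le> b\<close>] by (simp add: algebra_simps)
  ultimately show ?thesis using G by linarith
qed

section \<open>Estimation error\<close>

text \<open>Row j sums to 1, so x_j equals its total outflow including the holding part;
  stationarity at j says that outflow equals inflow.\<close>

lemma stationary_iff_balanced:
  fixes P :: matrix and x :: "nat \<Rightarrow> real"
  assumes rows: "\<And>i. i \<in> {1..n} \<Longrightarrow> (\<Sum>j\<in>{1..n}. P i j) = 1" and j: "j \<in> {1..n}"
  shows "(\<Sum>i\<in>{1..n}. x i * P i j) = x j \<longleftrightarrow> (\<Sum>i\<in>{1..n}. x j * P j i - x i * P i j) = 0"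
  using rows[OF j] by (simp add: sum_subtractf sum_distrib_left[symmetric]) auto

text \<open>Only off-diagonal entries enter the flux, and the common factor 1 / d rescales it.
  Existence comes from \<open>ex_balanced\<close>, uniqueness from the stability estimate, and the
  error bound after scaling x to the total of a.\<close>

lemma stationary_perturbation:
  fixes P :: matrix
  assumes pert: "btl_perturbation {1..n} a e b \<sigma> \<kappa>"
    and off: "\<And>i j. i \<in> {1..n} \<Longrightarrow> j \<in> {1..n} \<Longrightarrow> i \<noteq> j \<Longrightarrow> P i j = (a j / (a i + a j) + e i j) / d"
    and d: "0 < d" and P: "transition_matrix n P"
  shows stationary_ex1: "\<exists>!x. stationary_distribution n P x"
    and stationary_close: "\<And>x i. stationary_distribution n P x \<Longrightarrow> i \<in> {1..n} \<Longrightarrow>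
      \<bar>x i * (\<Sum>k\<in>{1..n}. a k) - a i\<bar> \<le> 16 * b * \<sigma> + 128 * b\<^sup>2 * \<kappa>\<^sup>2 / (n * sqrt n)"
proof -
  interpret btl_perturbation "{1..n}" a e b \<sigma> \<kappa> by (rule pert)
  have nonneg: "0 \<le> P i j" if "i \<in> {1..n}" "j \<in> {1..n}" for i j
    using P that by (simp add: transition_matrix_def)
  have rows: "(\<Sum>j\<in>{1..n}. P i j) = 1" if "i \<in> {1..n}" for i
    using P that by (simp add: transition_matrix_def)
  have flow: "(\<Sum>i\<in>{1..n}. x j * P j i - x i * P i j) = imbalance x j / d" if j: "j \<in> {1..n}" for x j
    unfolding imbalance_def sum_divide_distrib
  proof (rule sum.cong[OF refl])
    fix i assume i: "i \<in> {1..n}"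
    show "x j * P j i - x i * P i j = (x j * win_prob j i - x i * win_prob i j) / d"
      using off[OF i j] off[OF j i] by (cases "i = j") (simp_all add: win_prob_def diff_divide_distrib)
  qed
  have stat_iff: "stationary_distribution n P x \<longleftrightarrow> prob_vector n x \<and> (\<forall>j\<in>{1..n}. imbalance x j = 0)" for x
  proof -
    have "(\<Sum>i\<in>{1..n}. x i * P i j) = x j \<longleftrightarrow> imbalance x j = 0" if "j \<in> {1..n}" for j
      using stationary_iff_balanced[where x = x, OF rows that] flow[where x = x, OF that] d by simp
    then show ?thesis using P unfolding stationary_distribution_def by blast
  qed
  have "\<exists>z. stationary_distribution n P z"
  proof -
    obtain x where x: "\<And>i. i \<in> {1..n} \<Longrightarrow> 0 \<le> x i" "0 < (\<Sum>i\<in>{1..n}. x i)"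
      "\<And>i. i \<in> {1..n} \<Longrightarrow> (\<Sum>j\<in>{1..n}. x i * P i j) = (\<Sum>j\<in>{1..n}. x j * P j i)"
      using ex_balanced[of "{1..n}" P] finite_A nonempty_A nonneg by blast
    define s where "s = (\<Sum>i\<in>{1..n}. x i)"
    define z where "z i = (if i \<in> {1..n} then x i / s else 0)" for i
    have "prob_vector n z"
      using x(1,2) by (simp add: prob_vector_def z_def s_def sum_divide_distrib[symmetric])
    moreover have "imbalance z j = 0" if j: "j \<in> {1..n}" for j
    proof -
      have "imbalance z j / d = (\<Sum>i\<in>{1..n}. z j * P j i - z i * P i j)" by (rule flow[OF j, symmetric])
      also have "\<dots> = (\<Sum>i\<in>{1..n}. x j * P j i - x i * P i j) / s"
        using j by (simp add: z_def sum_divide_distrib diff_divide_distrib)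
      also have "\<dots> = 0" using x(3)[OF j] by (simp add: sum_subtractf)
      finally show ?thesis using d by simp
    qed
    ultimately show ?thesis unfolding stat_iff by blast
  qed
  moreover have "x = z" if "stationary_distribution n P x" "stationary_distribution n P z" for x z
  proof
    fix i show "x i = z i"
      using that balanced_unique[of x z i] unfolding stat_iff prob_vector_def
      by (cases "i \<in> {1..n}") (simp_all del: atLeastAtMost_iff)
  qed
  ultimately show "\<exists>!x. stationary_distribution n P x" by blast
  fix x i assume x: "stationary_distribution n P x" and i: "i \<in> {1..n}"
  define s where "s = (\<Sum>k\<in>{1..n}. a k)"
  have "imbalance (\<lambda>i. x i * s) j = s * imbalance x j" for j
    unfolding imbalance_def by (simp add: sum_distrib_left algebra_simps)
  then have "imbalance (\<lambda>i. x i * s) j = 0" if "j \<in> {1..n}" for j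
    using x that unfolding stat_iff by simp
  then have "\<bar>x i * s - a i\<bar> \<le> 16 * b * \<sigma> + 128 * b\<^sup>2 * \<kappa>\<^sup>2 / (card {1..n} * sqrt (card {1..n}))"
  proof (intro balanced_close i)
    have "(\<Sum>i\<in>{1..n}. x i) = 1" using x unfolding stat_iff prob_vector_def by blast
    then show "(\<Sum>i\<in>{1..n}. x i * s) = (\<Sum>i\<in>{1..n}. a i)"
      unfolding sum_distrib_right[symmetric] s_def[symmetric] by simp
  qed
  then show "\<bar>x i * (\<Sum>k\<in>{1..n}. a k) - a i\<bar> \<le> 16 * b * \<sigma> + 128 * b\<^sup>2 * \<kappa>\<^sup>2 / (n * sqrt n)"
    by (simp add: s_def)
qed

section \<open>Variation of the score ratio over the neighborhood\<close>

lemma b_ratio_ge: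
  assumes "i \<in> {1..n}" "j \<in> {1..n}"
  shows "w t i / w t j \<le> b_ratio n w t"
  unfolding b_ratio_def using assms by (intro Max_ge) (auto intro!: image_eqI[of _ _ "(i, j)"])

lemma b_ratio_attained:
  assumes "1 \<le> n"
  obtains i j where "i \<in> {1..n}" "j \<in> {1..n}" "b_ratio n w t = w t i / w t j"
proof -
  have "b_ratio n w t \<in> (\<lambda>(i, j). w t i / w t j) ` ({1..n} \<times> {1..n})"
    unfolding b_ratio_def using assms by (intro Max_in) auto
  then show ?thesis using that by auto
qed

lemma b_ratio_ge_1:
  assumes "positive_scores n w" "1 \<le> n" "0 \<le> t" "t \<le> 1"
  shows "1 \<le> b_ratio n w t"
proof -
  have "0 < w t 1" using assms by (simp add: positive_scores_def)
  then show ?thesis using b_ratio_ge[of 1 n 1 w t] assms(2) by simp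
qed

lemma y_star_ratio:
  assumes "0 < w s i" "0 < w s j"
  shows "y_star w s i j = 1 / (1 + w s i / w s j)"
  using assms by (simp add: y_star_def field_simps)

text \<open>A winning probability is 1 / (1 + r) in terms of the score ratio r. The shift \<mu> is
  at most one percent of 1 / (1 + b(t)), so the extreme ratio changes by little. The lower bound is
  read off at a pair extremal at t, the upper bound at a pair extremal at s.\<close>

lemma b_ratio_close:
  assumes w: "positive_scores n w" and n: "1 \<le> n" and t: "0 \<le> t" "t \<le> 1" and s: "0 \<le> s" "s \<le> 1"
    and close: "\<And>i j. i \<in> {1..n} \<Longrightarrow> j \<in> {1..n} \<Longrightarrow> i \<noteq> j \<Longrightarrow> \<bar>y_star w t i j - y_star w s i j\<bar> \<le> \<mu>"
    and \<mu>: "\<mu> * (1 + b_ratio n w t) \<le> 1 / 100"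
  shows "b_ratio n w t / 2 \<le> b_ratio n w s" and "b_ratio n w s \<le> 2 * b_ratio n w t"
proof -
  let ?\<beta> = "b_ratio n w t"
  have \<beta>: "1 \<le> ?\<beta>" "1 \<le> b_ratio n w s" using b_ratio_ge_1 w n t s by blast+
  have pos: "0 < w t i" "0 < w s i" if "i \<in> {1..n}" for i
    using w that t s by (simp_all add: positive_scores_def)
  have \<mu>': "\<mu> \<le> 1 / 100 * (1 / (1 + ?\<beta>))" using \<mu> \<beta> by (simp add: field_simps)
  obtain i j where ij: "i \<in> {1..n}" "j \<in> {1..n}" "?\<beta> = w t i / w t j" by (rule b_ratio_attained[OF n])
  show "?\<beta> / 2 \<le> b_ratio n w s"
  proof (cases "i = j")
    \<comment> \<open>The extremal pair may be diagonal; the ratio is then 1, and smoothness, stated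
      for distinct indices, is not invoked.\<close>
    case True
    then show ?thesis using \<beta> ij pos(1)[OF ij(2)] by simp
  next
    case False
    define r where "r = w s i / w s j"
    have r: "0 < r" "r \<le> b_ratio n w s" using pos ij b_ratio_ge[of i n j w s] by (auto simp: r_def)
    have "1 / (1 + r) \<le> 1 / (1 + ?\<beta>) + \<mu>"
      using close[OF ij(1,2) False] y_star_ratio[of w t i j] y_star_ratio[of w s i j] pos ij by (auto simp: r_def)
    also have "\<dots> \<le> 101 / 100 * (1 / (1 + ?\<beta>))" using \<mu>' by linarith
    finally have "100 * (1 + ?\<beta>) \<le> 101 * (1 + r)" using r \<beta> by (simp add: field_simps)
    then have "100 * ?\<beta> \<le> 1 + 101 * r" by simp
    then have "?\<beta> / 2 \<le> r" using \<beta>(1) by simp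
    then show ?thesis using r(2) by (rule order_trans)
  qed
  obtain i j where ij: "i \<in> {1..n}" "j \<in> {1..n}" "b_ratio n w s = w s i / w s j" by (rule b_ratio_attained[OF n])
  show "b_ratio n w s \<le> 2 * ?\<beta>"
  proof (cases "i = j")
    case True
    then show ?thesis using \<beta> ij pos(2)[OF ij(2)] by simp
  next
    case False
    define r where "r = w t i / w t j"
    have r: "0 < r" "r \<le> ?\<beta>" using pos ij b_ratio_ge[of i n j w t] by (auto simp: r_def)
    have "1 / (1 + r) \<le> 1 / (1 + b_ratio n w s) + \<mu>"
      using close[OF ij(1,2) False] y_star_ratio[of w t i j] y_star_ratio[of w s i j] pos ij by (auto simp: r_def)
    moreover have "1 / (1 + ?\<beta>) \<le> 1 / (1 + r)" using r \<beta> by (intro divide_left_mono) auto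
    ultimately have "99 / 100 * (1 / (1 + ?\<beta>)) \<le> 1 / (1 + b_ratio n w s)" using \<mu>' by linarith
    then have "99 * (1 + b_ratio n w s) \<le> 100 * (1 + ?\<beta>)" using \<beta> by (simp add: field_simps)
    then have "99 * b_ratio n w s \<le> 1 + 100 * ?\<beta>" by simp
    then show ?thesis using \<beta>(1) by simp
  qed
qed

text \<open>The grid has mesh 1 / T, so some grid point is within 1 / (2 T) of t. This makes the
  \<open>Max\<close> in \<open>b_max\<close> meaningful.\<close>

lemma nbhd_nonempty:
  assumes "1 \<le> T" "0 \<le> t" "t \<le> 1" "1 / 2 \<le> \<delta>"
  shows "nbhd T \<delta> t \<noteq> {}"
proof -
  \<comment> \<open>Rounding t T to the nearest integer; t \<le> 1 keeps the result within the
    grid.\<close>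
  define k where "k = nat \<lfloor>t * T + 1 / 2\<rfloor>"
  have "0 \<le> t * T" "t * T \<le> T" using assms by (simp_all add: mult_left_le_one_le)
  then have k: "\<bar>t * T - k\<bar> \<le> 1 / 2" "k \<le> T" unfolding k_def by linarith+
  have "t - k / T = (t * T - k) / T" using assms by (simp add: diff_divide_distrib)
  then have "\<bar>t - k / T\<bar> = \<bar>t * T - k\<bar> / T" by simp
  also have "\<dots> \<le> \<delta> / T" using k assms by (intro divide_right_mono) auto
  finally have "real k / T \<in> nbhd T \<delta> t" using k by (auto simp: nbhd_def grid_def)
  then show ?thesis by blast
qed

lemma smooth_nbhd:
  assumes "smooth_scores n w M" "0 \<le> t" "t \<le> 1" "s \<in> nbhd T \<delta> t" "i \<in> {1..n}" "j \<in> {1..n}" "i \<noteq> j"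
  shows "\<bar>y_star w t i j - y_star w s i j\<bar> \<le> M * \<delta> / T"
proof -
  have s: "0 \<le> s \<and> s \<le> 1" "\<bar>t - s\<bar> \<le> \<delta> / T" using assms(4) grid_unit by (auto simp: nbhd_def)
  have "\<bar>y_star w t i j - y_star w s i j\<bar> \<le> M * \<bar>t - s\<bar>"
    using assms s(1) by (simp add: smooth_scores_def)
  also have "\<dots> \<le> M * (\<delta> / T)" using assms(1) s(2) by (intro mult_left_mono) (auto simp: smooth_scores_def)
  finally show ?thesis by simp
qed

text \<open>The analysis uses b(t) alone while the theorem is stated with the maximum over the
  neighborhood; a factor 2 converts one into the other.\<close>

lemma b_max_bounds:
  assumes w: "positive_scores n w" and n: "1 \<le> n" and smooth: "smooth_scores n w M"
    and T: "1 \<le> T" and t: "0 \<le> t" "t \<le> 1" and \<delta>: "1 / 2 \<le> \<delta>"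
    and \<mu>: "M * \<delta> / T * (1 + b_ratio n w t) \<le> 1 / 100"
  shows "b_ratio n w t / 2 \<le> b_max n T w \<delta> t" and "b_max n T w \<delta> t \<le> 2 * b_ratio n w t"
proof -
  have ne: "nbhd T \<delta> t \<noteq> {}" by (rule nbhd_nonempty[OF T t \<delta>])
  have close: "b_ratio n w t / 2 \<le> b_ratio n w s" "b_ratio n w s \<le> 2 * b_ratio n w t" if "s \<in> nbhd T \<delta> t" for s
  proof -
    have s: "0 \<le> s" "s \<le> 1" using that nbhd_subset grid_unit by blast+
    show "b_ratio n w t / 2 \<le> b_ratio n w s" "b_ratio n w s \<le> 2 * b_ratio n w t"
      using b_ratio_close[OF w n t s smooth_nbhd[OF smooth t that] \<mu>] by auto
  qed
  show "b_max n T w \<delta> t \<le> 2 * b_ratio n w t"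
    unfolding b_max_def using ne close by (intro Max.boundedI) auto
  obtain s where s: "s \<in> nbhd T \<delta> t" using ne by blast
  then have "b_ratio n w s \<le> b_max n T w \<delta> t" unfolding b_max_def by (intro Max_ge) auto
  then show "b_ratio n w t / 2 \<le> b_max n T w \<delta> t" using close(1)[OF s] by linarith
qed

section \<open>Bias, transition matrix and the deterministic error bound\<close>

text \<open>The part of the error that comes from averaging over nearby times. Given the graphs it
  is deterministic, so smoothness bounds it entrywise.\<close>

definition bias :: "nat \<Rightarrow> (real \<Rightarrow> nat \<Rightarrow> real) \<Rightarrow> real \<Rightarrow> real \<Rightarrow> graphs \<Rightarrow> matrix" where
  "bias T w \<delta> t E i j =
     (if i = j then 0
      else (\<Sum>s\<in>nbhd_edge T E \<delta> t i j. y_star w s i j - y_star w t i j) / card (nbhd_edge T E \<delta> t i j))"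

lemma bias_antisym:
  assumes "positive_scores n w" "0 \<le> t" "t \<le> 1" "i \<in> {1..n}" "j \<in> {1..n}"
  shows "bias T w \<delta> t E j i = - bias T w \<delta> t E i j"
proof (cases "i = j")
  case False
  have "y_star w s j i - y_star w t j i = - (y_star w s i j - y_star w t i j)"
    if "s \<in> nbhd_edge T E \<delta> t i j" for s
  proof -
    have "s \<in> grid T" using that nbhd_subset by (auto simp: nbhd_edge_def)
    from grid_unit[OF this] show ?thesis
      using y_star_commute[OF assms(1,4,5), of s] y_star_commute[OF assms(1,4,5), of t] assms by auto
  qed
  then have "(\<Sum>s\<in>nbhd_edge T E \<delta> t i j. y_star w s j i - y_star w t j i)
      = (\<Sum>s\<in>nbhd_edge T E \<delta> t i j. - (y_star w s i j - y_star w t i j))"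
    by (intro sum.cong refl)
  also have "\<dots> = - (\<Sum>s\<in>nbhd_edge T E \<delta> t i j. y_star w s i j - y_star w t i j)"
    by (simp only: sum_negf)
  finally show ?thesis using False
    by (simp only: bias_def nbhd_edge_commute[of T E \<delta> t j i] minus_divide_left if_False) simp
qed (simp add: bias_def)

lemma bias_le:
  assumes "smooth_scores n w M" "0 \<le> t" "t \<le> 1" "i \<in> {1..n}" "j \<in> {1..n}" "0 \<le> M * \<delta> / T"
  shows "\<bar>bias T w \<delta> t E i j\<bar> \<le> M * \<delta> / T"
proof (cases "i = j \<or> nbhd_edge T E \<delta> t i j = {}")
  case False
  let ?N = "nbhd_edge T E \<delta> t i j"
  have "\<bar>\<Sum>s\<in>?N. y_star w s i j - y_star w t i j\<bar> \<le> (\<Sum>s\<in>?N. \<bar>y_star w s i j - y_star w t i j\<bar>)"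
    by (rule sum_abs)
  also have "\<dots> \<le> card ?N * (M * \<delta> / T)"
    using smooth_nbhd[OF assms(1-3)] assms(4,5) False
    by (intro sum_bounded_above) (auto simp: nbhd_edge_def abs_minus_commute)
  finally show ?thesis using False
    by (simp add: bias_def card_gt_0_iff pos_divide_le_eq mult.commute)
qed (use assms in \<open>auto simp: bias_def\<close>)

text \<open>Entrywise bounds give \<mu> times the product of the l1 norms, and each l1 norm is at
  most sqrt n times the l2 norm. The bias thus adds n \<mu> to the operator bound.\<close>

lemma bilin_bounded_entries:
  fixes \<mu> :: real
  assumes A: "finite A" and e: "\<And>i j. i \<in> A \<Longrightarrow> j \<in> A \<Longrightarrow> \<bar>e i j\<bar> \<le> \<mu>" and \<mu>: "0 \<le> \<mu>"
  shows "\<bar>bilin A e x z\<bar> \<le> card A * \<mu> * L2_set x A * L2_set z A"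
proof -
  have l1: "(\<Sum>i\<in>A. \<bar>x i\<bar>) \<le> sqrt (card A) * L2_set x A" for x
    using L2_set_mult_ineq[of "\<lambda>_. 1" x A] by (simp add: L2_set_def)
  have "\<bar>bilin A e x z\<bar> \<le> (\<Sum>i\<in>A. \<bar>x i * (\<Sum>j\<in>A. e i j * z j)\<bar>)"
    unfolding bilin_def by (rule sum_abs)
  also have "\<dots> \<le> (\<Sum>i\<in>A. \<bar>x i\<bar> * (\<mu> * (\<Sum>j\<in>A. \<bar>z j\<bar>)))"
  proof (rule sum_mono)
    fix i assume i: "i \<in> A"
    have "\<bar>\<Sum>j\<in>A. e i j * z j\<bar> \<le> (\<Sum>j\<in>A. \<bar>e i j * z j\<bar>)" by (rule sum_abs)
    also have "\<dots> \<le> (\<Sum>j\<in>A. \<mu> * \<bar>z j\<bar>)" using e[OF i] by (intro sum_mono) (auto simp: abs_mult intro!: mult_right_mono)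
    finally show "\<bar>x i * (\<Sum>j\<in>A. e i j * z j)\<bar> \<le> \<bar>x i\<bar> * (\<mu> * (\<Sum>j\<in>A. \<bar>z j\<bar>))"
      by (simp add: abs_mult sum_distrib_left[symmetric] mult_left_mono)
  qed
  also have "\<dots> = \<mu> * ((\<Sum>i\<in>A. \<bar>x i\<bar>) * (\<Sum>j\<in>A. \<bar>z j\<bar>))"
    by (simp add: sum_distrib_right[symmetric])
  also have "\<dots> \<le> \<mu> * ((sqrt (card A) * L2_set x A) * (sqrt (card A) * L2_set z A))"
    using \<mu> by (intro mult_left_mono mult_mono l1) (auto intro: sum_nonneg)
  also have "\<dots> = (sqrt (card A) * sqrt (card A)) * \<mu> * L2_set x A * L2_set z A"
    by (simp only: ac_simps)
  finally show ?thesis by simp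
qed

text \<open>Each observation at time s is split as (y - y*(s)) + (y*(s) - y*(t)) + y*(t). The number
  of comparison times cancels, which leaves the form required of the perturbed chain.\<close>

lemma y_mean_decomposition:
  assumes L: "1 \<le> L" and ij: "i \<noteq> j" and N: "0 < card (nbhd_edge T E \<delta> t i j)"
  shows "1 / (d * real (card (nbhd_edge T E \<delta> t i j))) * (\<Sum>s\<in>nbhd_edge T E \<delta> t i j. y_mean L Y s i j)
    = (y_star w t i j + (noise T L w \<delta> t E Y i j + bias T w \<delta> t E i j)) / d"
proof -
  let ?N = "nbhd_edge T E \<delta> t i j"
  have "(\<Sum>s\<in>?N. y_mean L Y s i j) = (\<Sum>s\<in>?N. (\<Sum>l\<in>{1..L}. y_obs Y l s i j - y_star w s i j) / L
      + (y_star w s i j - y_star w t i j) + y_star w t i j)"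
    using L by (intro sum.cong refl) (simp add: y_mean_def sum_subtractf diff_divide_distrib)
  also have "\<dots> = card ?N * (noise T L w \<delta> t E Y i j + bias T w \<delta> t E i j + y_star w t i j)"
    using N ij L by (simp add: noise_def bias_def sum.distrib sum_subtractf sum_divide_distrib[symmetric] distrib_left)
  finally show ?thesis using N by (auto simp: card_gt_0_iff)
qed

lemma y_mean_bounds:
  assumes "1 \<le> L"
  shows "0 \<le> y_mean L Y s i j" "y_mean L Y s i j \<le> 1"
proof -
  have "0 \<le> y_obs Y l s i j" "y_obs Y l s i j \<le> 1" for l by (auto simp: y_obs_def)
  then have "0 \<le> (\<Sum>l\<in>{1..L}. y_obs Y l s i j)" "(\<Sum>l\<in>{1..L}. y_obs Y l s i j) \<le> real (card {1..L}) * 1"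
    by (intro sum_nonneg sum_bounded_above; simp)+
  then show "0 \<le> y_mean L Y s i j" "y_mean L Y s i j \<le> 1"
    using assms by (simp_all add: y_mean_def)
qed

text \<open>Every off-diagonal entry is at most 1 / d, so with d \<ge> n the n - 1 of them in a row
  sum to at most 1, whatever the graphs and outcomes.\<close>

lemma P_hat_transition:
  assumes L: "1 \<le> L" and d: "real n \<le> d" "0 < d"
  shows "transition_matrix n (P_hat n T L d \<delta> t E Y)"
proof -
  have off: "0 \<le> P_hat_off T L d \<delta> t E Y i j \<and> P_hat_off T L d \<delta> t E Y i j \<le> 1 / d" for i j
  proof -
    let ?N = "nbhd_edge T E \<delta> t i j"
    have "0 \<le> (\<Sum>s\<in>?N. y_mean L Y s i j)" "(\<Sum>s\<in>?N. y_mean L Y s i j) \<le> real (card ?N) * 1"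
      using y_mean_bounds[OF L] by (intro sum_nonneg sum_bounded_above; simp)+
    then have "0 \<le> (\<Sum>s\<in>?N. y_mean L Y s i j) / card ?N \<and> (\<Sum>s\<in>?N. y_mean L Y s i j) / card ?N \<le> 1"
      by (cases "card ?N = 0") (auto simp only: divide_le_eq_1 intro!: divide_nonneg_nonneg; simp)+
    then have "0 \<le> (\<Sum>s\<in>?N. y_mean L Y s i j) / card ?N / d" "(\<Sum>s\<in>?N. y_mean L Y s i j) / card ?N / d \<le> 1 / d"
      using d by (auto intro!: divide_right_mono simp del: divide_divide_eq_left)
    then show ?thesis using d by (simp add: P_hat_off_def mult.commute)
  qed
  have "0 \<le> P_hat n T L d \<delta> t E Y i j" if i: "i \<in> {1..n}" for i j
  proof (cases "i = j")
    case True
    have "(\<Sum>k\<in>{1..n} - {i}. P_hat_off T L d \<delta> t E Y i k) \<le> real (card ({1..n} - {i})) * (1 / d)"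
      using off by (intro sum_bounded_above) auto
    also have "\<dots> \<le> 1" using d i by (simp add: field_simps)
    finally show ?thesis using True by (simp add: P_hat_def)
  qed (use off in \<open>simp add: P_hat_def\<close>)
  moreover have "(\<Sum>j\<in>{1..n}. P_hat n T L d \<delta> t E Y i j) = 1" if i: "i \<in> {1..n}" for i
  proof -
    have "(\<Sum>j\<in>{1..n}. P_hat n T L d \<delta> t E Y i j)
        = P_hat n T L d \<delta> t E Y i i + (\<Sum>j\<in>{1..n} - {i}. P_hat n T L d \<delta> t E Y i j)"
      using i by (intro sum.remove) auto
    also have "(\<Sum>j\<in>{1..n} - {i}. P_hat n T L d \<delta> t E Y i j) = (\<Sum>j\<in>{1..n} - {i}. P_hat_off T L d \<delta> t E Y i j)"
      by (intro sum.cong) (auto simp: P_hat_def)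
    finally show ?thesis by (simp add: P_hat_def)
  qed
  ultimately show ?thesis by (simp add: transition_matrix_def)
qed

text \<open>The deterministic half of the proof: on outcomes obeying the operator bound and the two
  row bounds, the estimator exists and is close. With max a = 1, dividing by the sup norm of the
  target cancels the total of a.\<close>

lemma estimation_error:
  fixes n T L :: nat and w :: "real \<Rightarrow> nat \<Rightarrow> real" and M \<delta> t d \<epsilon> \<rho> \<beta> \<mu> :: real and a :: "nat \<Rightarrow> real"
    and E :: graphs and Y :: outcomes
  defines "\<beta> \<equiv> b_ratio n w t" and "\<mu> \<equiv> M * \<delta> / T" and "a \<equiv> (\<lambda>i. w t i / Max (w t ` {1..n}))"
  assumes n: "1 \<le> ln n" and T: "1 \<le> T" and L: "1 \<le> L"
    and w: "positive_scores n w" and smooth: "smooth_scores n w M" and t: "0 \<le> t" "t \<le> 1" and \<delta>: "1 / 2 \<le> \<delta>"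
    and N: "\<And>i j. i \<in> {1..n} \<Longrightarrow> j \<in> {i<..n} \<Longrightarrow> 0 < card (nbhd_edge T E \<delta> t i j)"
    and d: "real n \<le> d" and \<epsilon>: "0 < \<epsilon>"
    and op: "\<And>x z. \<bar>bilin {1..n} (noise T L w \<delta> t E Y) x z\<bar>
               \<le> 14 * sqrt n * \<epsilon> * L2_set x {1..n} * L2_set z {1..n}"
    and row: "\<And>i. i \<in> {1..n} \<Longrightarrow> \<bar>\<Sum>j\<in>{1..n}. noise T L w \<delta> t E Y i j\<bar> \<le> sqrt (10 * real n * ln n) * \<epsilon>"
    and row_a: "\<And>i. i \<in> {1..n} \<Longrightarrow> \<bar>\<Sum>j\<in>{1..n}. noise T L w \<delta> t E Y i j * a j\<bar> \<le> sqrt (10 * real n * ln n) * \<epsilon>"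
    and \<rho>: "sqrt (n * ln n) * \<epsilon> \<le> n * \<rho>" and small: "8 * \<beta> * (14 * \<rho> + \<mu>) \<le> 1 / 2"
  shows "pi_hat_defined n T L d \<delta> t E Y"
    and "sup_norm n (\<lambda>i. pi_hat n T L d \<delta> t E Y i - pi_star n w t i) / sup_norm n (pi_star n w t)
      \<le> 16 * \<beta> * (14 * \<rho> + \<mu>) + 128 * \<beta>\<^sup>2 * (14 * sqrt n * \<epsilon> + n * \<mu>)\<^sup>2 / (n * sqrt n)"
proof -
  let ?P = "P_hat n T L d \<delta> t E Y"
  define m where "m = Max (w t ` {1..n})"
  define e where "e = (\<lambda>i j. noise T L w \<delta> t E Y i j + bias T w \<delta> t E i j)"
  \<comment> \<open>The factor 14 covers the row constant sqrt 10 as well as the operator constant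
    14, as \<kappa> \<le> n \<sigma> requires.\<close>
  define \<sigma> where "\<sigma> = 14 * \<rho> + \<mu>"
  define \<kappa> where "\<kappa> = 14 * sqrt n * \<epsilon> + n * \<mu>"
  have n1: "1 \<le> n" using n by (cases n) auto
  have \<mu>: "0 \<le> \<mu>" using smooth \<delta> by (simp add: \<mu>_def smooth_scores_def)
  have pos: "0 < w t i" if "i \<in> {1..n}" for i using w that t by (simp add: positive_scores_def)
  have m_ge: "w t i \<le> m" if "i \<in> {1..n}" for i unfolding m_def using that by (intro Max_ge) auto
  have "m \<in> w t ` {1..n}" unfolding m_def using n1 by (intro Max_in) auto
  then obtain k where k: "k \<in> {1..n}" "m = w t k" by blast
  have m: "0 < m" using pos k by simp
  have a_eq: "a i = w t i / m" for i by (simp add: a_def m_def)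
  have a: "0 < a i" "a i \<le> 1" "1 / \<beta> \<le> a i" if i: "i \<in> {1..n}" for i
  proof -
    show "0 < a i" "a i \<le> 1" using pos[OF i] m m_ge[OF i] by (simp_all add: a_eq)
    have "m / w t i \<le> \<beta>" using b_ratio_ge[OF k(1) i] by (simp add: k(2) \<beta>_def)
    then have "1 / \<beta> \<le> 1 / (m / w t i)" using m pos[OF i] by (intro frac_le) auto
    then show "1 / \<beta> \<le> a i" by (simp add: a_eq)
  qed
  have y_star_a: "y_star w t i j = a j / (a i + a j)" if "i \<in> {1..n}" "j \<in> {1..n}" for i j
    using m pos[OF that(1)] pos[OF that(2)] by (simp add: y_star_def a_eq add_divide_distrib[symmetric])
  have bias: "\<bar>bias T w \<delta> t E i j\<bar> \<le> \<mu>" if "i \<in> {1..n}" "j \<in> {1..n}" for i j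
    unfolding \<mu>_def by (rule bias_le[OF smooth t that]) (use \<mu> in \<open>simp add: \<mu>_def\<close>)
  have r10: "sqrt (10 * real n * ln n) * \<epsilon> \<le> 14 * (n * \<rho>)"
  proof -
    have "sqrt (10 * real n * ln n) = sqrt 10 * sqrt (n * ln n)" by (simp add: real_sqrt_mult[symmetric] mult.assoc)
    moreover have "sqrt 10 \<le> 14" by (rule real_le_lsqrt) auto
    ultimately have "sqrt (10 * real n * ln n) * \<epsilon> \<le> 14 * sqrt (n * ln n) * \<epsilon>"
      using n \<epsilon> by (simp only:) (intro mult_right_mono; simp)
    then show ?thesis using \<rho> by simp
  qed
  have row_bias: "\<bar>\<Sum>j\<in>{1..n}. bias T w \<delta> t E i j * z j\<bar> \<le> n * \<mu>"
    if i: "i \<in> {1..n}" and z: "\<And>j. j \<in> {1..n} \<Longrightarrow> \<bar>z j\<bar> \<le> 1" for i z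
  proof -
    have "\<bar>\<Sum>j\<in>{1..n}. bias T w \<delta> t E i j * z j\<bar> \<le> (\<Sum>j\<in>{1..n}. \<bar>bias T w \<delta> t E i j * z j\<bar>)"
      by (rule sum_abs)
    also have "\<dots> \<le> real (card {1..n}) * (\<mu> * 1)"
      unfolding abs_mult using bias[OF i] z \<mu> by (intro sum_bounded_above mult_mono) auto
    finally show ?thesis by simp
  qed
  have pert: "btl_perturbation {1..n} a e \<beta> \<sigma> \<kappa>"
  proof
    show "1 \<le> \<beta>" unfolding \<beta>_def by (rule b_ratio_ge_1[OF w n1 t])
    show "e j i = - e i j" if "i \<in> {1..n}" "j \<in> {1..n}" for i j
      using noise_antisym[OF w that, of T L \<delta> t E Y] bias_antisym[OF w t that, of T \<delta> E] by (simp add: e_def)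
    show "\<bar>\<Sum>j\<in>{1..n}. e i j\<bar> \<le> card {1..n} * \<sigma>" if "i \<in> {1..n}" for i
      using row[OF that] row_bias[OF that, of "\<lambda>_. 1"] r10 by (simp add: e_def sum.distrib \<sigma>_def distrib_left)
    show "\<bar>\<Sum>j\<in>{1..n}. e i j * a j\<bar> \<le> card {1..n} * \<sigma>" if "i \<in> {1..n}" for i
    proof -
      have "\<bar>\<Sum>j\<in>{1..n}. bias T w \<delta> t E i j * a j\<bar> \<le> n * \<mu>"
        using a by (intro row_bias[OF that]) (auto simp: less_imp_le)
      moreover have "(\<Sum>j\<in>{1..n}. e i j * a j) = (\<Sum>j\<in>{1..n}. noise T L w \<delta> t E Y i j * a j) + (\<Sum>j\<in>{1..n}. bias T w \<delta> t E i j * a j)"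
        by (simp add: e_def distrib_right sum.distrib)
      moreover have "card {1..n} * \<sigma> = 14 * (n * \<rho>) + n * \<mu>" by (simp add: \<sigma>_def distrib_left)
      ultimately show ?thesis using row_a[OF that] r10 by linarith
    qed
    show "\<bar>\<Sum>i\<in>{1..n}. x i * (\<Sum>j\<in>{1..n}. e i j * z j)\<bar> \<le> \<kappa> * L2_set x {1..n} * L2_set z {1..n}" for x z
    proof -
      have "\<bar>bilin {1..n} e x z\<bar> \<le> \<bar>bilin {1..n} (noise T L w \<delta> t E Y) x z\<bar> + \<bar>bilin {1..n} (bias T w \<delta> t E) x z\<bar>"
        unfolding e_def bilin_add_matrix by (rule abs_triangle_ineq)
      moreover have "\<bar>bilin {1..n} (bias T w \<delta> t E) x z\<bar> \<le> n * \<mu> * L2_set x {1..n} * L2_set z {1..n}"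
        using bilin_bounded_entries[of "{1..n}" "bias T w \<delta> t E" \<mu> x z] bias \<mu> by simp
      ultimately show ?thesis using op[of x z] unfolding bilin_def[of _ e] \<kappa>_def
        by (simp add: distrib_right)
    qed
    show "0 \<le> \<kappa>" using \<epsilon> \<mu> by (simp add: \<kappa>_def)
    show "\<kappa> \<le> card {1..n} * \<sigma>"
    proof -
      \<comment> \<open>This comparison is where log n \<ge> 1 enters.\<close>
      have "sqrt n * 1 \<le> sqrt (n * ln n)" using n unfolding real_sqrt_mult by (intro mult_left_mono) auto
      from mult_right_mono[OF this, of \<epsilon>] have "sqrt n * \<epsilon> \<le> n * \<rho>" using \<rho> \<epsilon> by linarith
      then show ?thesis by (simp add: \<kappa>_def \<sigma>_def distrib_left)
    qed
    show "8 * \<beta> * \<sigma> \<le> 1 / 2" using small by (simp add: \<sigma>_def)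
  qed (use a n1 in auto)
  have d0: "0 < d" using d n1 by linarith
  have off: "?P i j = (a j / (a i + a j) + e i j) / d" if ij: "i \<in> {1..n}" "j \<in> {1..n}" "i \<noteq> j" for i j
  proof -
    have card: "0 < card (nbhd_edge T E \<delta> t i j)"
      using N[of i j] N[of j i] ij nbhd_edge_commute[of T E \<delta> t j i] by (cases "i < j") auto
    then have "{i, j} \<in> union_edges T E \<delta> t"
      by (auto simp: union_edges_def nbhd_edge_def card_gt_0_iff)
    then show ?thesis using ij y_mean_decomposition[OF L ij(3) card, of d Y w]
      by (simp add: P_hat_def P_hat_off_def y_star_a[OF ij(1,2)] e_def)
  qed
  note P = P_hat_transition[OF L d d0, of T \<delta> t E Y]
  show "pi_hat_defined n T L d \<delta> t E Y"
    unfolding pi_hat_defined_def by (rule stationary_ex1[OF pert off d0 P])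
  define x where "x = pi_hat n T L d \<delta> t E Y"
  have x: "stationary_distribution n ?P x"
    unfolding x_def pi_hat_def by (rule theI'[OF stationary_ex1[OF pert off d0 P]])
  define s where "s = (\<Sum>k\<in>{1..n}. a k)"
  have s: "0 < s" unfolding s_def using n1 a by (intro sum_pos) auto
  let ?U = "16 * \<beta> * \<sigma> + 128 * \<beta>\<^sup>2 * \<kappa>\<^sup>2 / (n * sqrt n)"
  have close: "\<bar>x i * s - a i\<bar> \<le> ?U" if "i \<in> {1..n}" for i
    unfolding s_def by (rule stationary_close[OF pert off d0 P x that])
  have "s = (\<Sum>k\<in>{1..n}. w t k) / m"
    unfolding s_def sum_divide_distrib by (intro sum.cong refl a_eq)
  then have pi_a: "pi_star n w t i = a i / s" for i
    using m by (simp add: pi_star_def a_eq)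
  have "1 / s \<le> sup_norm n (pi_star n w t)"
  proof -
    have "a k = 1" using k m by (simp add: a_eq)
    then have "1 / s = \<bar>pi_star n w t k\<bar>" using s by (simp add: pi_a)
    then show ?thesis unfolding sup_norm_def using k by (auto intro!: Max_ge)
  qed
  moreover have "sup_norm n (\<lambda>i. x i - pi_star n w t i) \<le> ?U / s"
    unfolding sup_norm_def
  proof (rule Max.boundedI)
    fix v assume "v \<in> (\<lambda>i. \<bar>x i - pi_star n w t i\<bar>) ` {1..n}"
    then obtain i where i: "i \<in> {1..n}" "v = \<bar>x i - pi_star n w t i\<bar>" by blast
    have "x i - pi_star n w t i = (x i * s - a i) / s" using s by (simp add: pi_a diff_divide_distrib)
    then have "v = \<bar>x i * s - a i\<bar> / s" using s i by simp
    then show "v \<le> ?U / s" using close[OF i(1)] s by (simp add: divide_right_mono)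
  qed (use n1 in auto)
  moreover have "0 \<le> ?U" using close[OF k(1)] by linarith
  ultimately have "sup_norm n (\<lambda>i. x i - pi_star n w t i) / sup_norm n (pi_star n w t) \<le> (?U / s) / (1 / s)"
    using s by (intro frac_le) auto
  also have "\<dots> = ?U" using s by simp
  finally show "sup_norm n (\<lambda>i. pi_hat n T L d \<delta> t E Y i - pi_star n w t i) / sup_norm n (pi_star n w t)
      \<le> 16 * \<beta> * (14 * \<rho> + \<mu>) + 128 * \<beta>\<^sup>2 * (14 * sqrt n * \<epsilon> + n * \<mu>)\<^sup>2 / (n * sqrt n)"
    by (simp add: x_def \<sigma>_def \<kappa>_def)
qed

section \<open>Collecting constants and probabilities\<close>

text \<open>Here q stands for log n. The quadratic noise term is at most a multiple of \<rho> / sqrt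
  q because \<epsilon> \<le> 1, the quadratic bias is at most \<mu> because n \<mu> \<le> 1, and
  extra powers of \<beta> fit into the two target terms.\<close>

lemma error_bound_simplify:
  fixes n \<beta> \<rho> \<mu> \<epsilon> q g :: real
  assumes \<beta>: "1 \<le> \<beta>" and n: "1 \<le> n" and q: "1 \<le> q" and \<rho>: "0 \<le> \<rho>" and \<mu>: "0 \<le> \<mu>" and \<epsilon>: "0 < \<epsilon>" "\<epsilon> \<le> 1"
    and \<epsilon>\<rho>: "sqrt (n * q) * \<epsilon> \<le> n * \<rho>" and n\<mu>: "n * \<mu> \<le> 1"
  shows "16 * \<beta> * (14 * \<rho> + \<mu>) + 128 * \<beta>\<^sup>2 * (14 * sqrt n * \<epsilon> + n * \<mu>)\<^sup>2 / (n * sqrt n)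
    \<le> 6 * \<beta> * (10000 * (1 + \<beta> powr (5/2) / sqrt q * max (\<beta>\<^sup>2) g) * \<rho> + 50 * (n * \<mu> * \<beta> powr (7/2)))"
proof -
  define r where "r = sqrt n"
  have r: "1 \<le> r" "r * r = n" using n by (simp_all add: r_def)
  define B where "B = \<beta> powr (5/2) * max (\<beta>\<^sup>2) g"
  define \<tau> where "\<tau> = \<rho> / sqrt q"
  have \<tau>: "0 \<le> \<tau>" using \<rho> q by (simp add: \<tau>_def)
  have "\<epsilon>\<^sup>2 / r \<le> \<tau>"
  proof -
    have "r * (sqrt q * \<epsilon>) \<le> r * (r * \<rho>)" using \<epsilon>\<rho> r by (simp add: real_sqrt_mult r_def[symmetric] mult.assoc[symmetric])
    then have "sqrt q * \<epsilon> \<le> r * \<rho>" using r by simp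
    moreover have "sqrt q * \<epsilon>\<^sup>2 \<le> sqrt q * \<epsilon>"
      using \<epsilon> q by (intro mult_left_mono) (auto simp: power2_eq_square mult_left_le_one_le)
    ultimately have "sqrt q * \<epsilon>\<^sup>2 \<le> r * \<rho>" by linarith
    then show ?thesis using q r by (simp add: \<tau>_def field_simps)
  qed
  moreover have "r * \<mu>\<^sup>2 \<le> \<mu>"
  proof -
    have "r * \<mu> \<le> r * r * \<mu>" using r \<mu> by (intro mult_right_mono) auto
    then have "r * \<mu> \<le> 1" using r n\<mu> by simp
    from mult_right_mono[OF this \<mu>] show ?thesis by (simp add: power2_eq_square mult.assoc)
  qed
  \<comment> \<open>The square of a sum is at most twice the sum of squares, and 392 = 2 *
    14^2.\<close>
  moreover have "(14 * sqrt n * \<epsilon> + n * \<mu>)\<^sup>2 / (n * sqrt n) \<le> 392 * (\<epsilon>\<^sup>2 / r) + 2 * (r * \<mu>\<^sup>2)"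
  proof -
    have "(14 * r * \<epsilon> + n * \<mu>)\<^sup>2 \<le> 2 * (14 * r * \<epsilon>)\<^sup>2 + 2 * (n * \<mu>)\<^sup>2"
      using zero_le_power2[of "14 * r * \<epsilon> - n * \<mu>"] by (simp add: power2_sum power2_diff)
    also have "\<dots> = (392 * (\<epsilon>\<^sup>2 / r) + 2 * (r * \<mu>\<^sup>2)) * (n * r)"
      using r by (simp add: r(2)[symmetric] field_simps power2_eq_square)
    finally show ?thesis using n r by (simp add: r_def[symmetric] pos_divide_le_eq)
  qed
  ultimately have V: "(14 * sqrt n * \<epsilon> + n * \<mu>)\<^sup>2 / (n * sqrt n) \<le> 392 * \<tau> + 2 * \<mu>" by linarith
  have p1: "1 \<le> \<beta> powr (5/2)" using \<beta> by (simp add: ge_one_powr_ge_zero)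
  have "\<beta> \<le> \<beta>\<^sup>2" using \<beta> by (simp add: power2_eq_square)
  then have "1 * \<beta> \<le> B" unfolding B_def using p1 \<beta> by (intro mult_mono) auto
  then have \<beta>B: "\<beta> * \<tau> \<le> B * \<tau>" using \<tau> by (intro mult_right_mono) auto
  have "1 * \<mu> * \<beta> powr 1 \<le> n * \<mu> * \<beta> powr (7/2)"
    using n \<mu> \<beta> by (intro mult_mono powr_mono) auto
  then have \<beta>\<mu>: "\<mu> * \<beta> \<le> n * \<mu> * \<beta> powr (7/2)" using \<beta> by simp
  have \<mu>\<beta>: "\<mu> \<le> \<mu> * \<beta>" using \<mu> \<beta> by (simp add: mult_le_cancel_left1)
  have "16 * \<beta> * (14 * \<rho> + \<mu>) + 128 * \<beta>\<^sup>2 * ((14 * sqrt n * \<epsilon> + n * \<mu>)\<^sup>2 / (n * sqrt n))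
      \<le> 16 * \<beta> * (14 * \<rho> + \<mu>) + 128 * \<beta>\<^sup>2 * (392 * \<tau> + 2 * \<mu>)"
    using V by (intro add_left_mono mult_left_mono) auto
  also have "\<dots> = \<beta> * (224 * \<rho> + 16 * \<mu> + 50176 * (\<beta> * \<tau>) + 256 * (\<mu> * \<beta>))"
    by (simp add: power2_eq_square algebra_simps)
  \<comment> \<open>The constants are 6 * 10000, which covers 50176 = 128 * 392, and 6 * 50, which
    covers 16 + 256.\<close>
  also have "\<dots> \<le> \<beta> * (60000 * \<rho> + 60000 * (B * \<tau>) + 300 * (n * \<mu> * \<beta> powr (7/2)))"
  proof (rule mult_left_mono)
    have "0 \<le> \<beta> * \<tau>" using \<beta> \<tau> by simp
    then show "224 * \<rho> + 16 * \<mu> + 50176 * (\<beta> * \<tau>) + 256 * (\<mu> * \<beta>)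
        \<le> 60000 * \<rho> + 60000 * (B * \<tau>) + 300 * (n * \<mu> * \<beta> powr (7/2))"
      using \<rho> \<beta>B \<beta>\<mu> \<mu>\<beta> \<mu> by linarith
  qed (use \<beta> in simp)
  also have "\<dots> = 6 * \<beta> * (10000 * (1 + B / sqrt q) * \<rho> + 50 * (n * \<mu> * \<beta> powr (7/2)))"
    by (simp add: \<tau>_def algebra_simps)
  finally show ?thesis by (simp add: B_def)
qed

text \<open>From 1 - p \<le> exp(- p), the probability of missing an edge at all times is at most
  exp(- P) \<le> 1/2. Hence n \<open>p_union\<close> is comparable to n.\<close>

lemma p_union_bounds:
  assumes p: "\<And>s. s \<in> grid T \<Longrightarrow> 0 \<le> p s \<and> p s \<le> 1" and psum: "1 \<le> p_sum T p \<delta> t"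
  shows "1 / 2 \<le> p_union T p \<delta> t" and "p_union T p \<delta> t \<le> 1"
proof -
  have p: "0 \<le> p s" "p s \<le> 1" if "s \<in> nbhd T \<delta> t" for s using p[of s] that nbhd_subset[of T \<delta> t] by auto
  have "(\<Prod>s\<in>nbhd T \<delta> t. 1 - p s) \<le> (\<Prod>s\<in>nbhd T \<delta> t. exp (- p s))"
    using p exp_ge_add_one_self[of "- p _"] by (intro prod_mono) auto
  also have "\<dots> = exp (- p_sum T p \<delta> t)" by (simp add: exp_sum[symmetric] p_sum_def sum_negf)
  also have "\<dots> \<le> exp (- 1)" using psum by simp
  also have "\<dots> \<le> 1 / 2" using exp_ge_add_one_self[of 1] by (simp add: exp_minus field_simps)
  finally show "1 / 2 \<le> p_union T p \<delta> t" by (simp add: p_union_def)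
  show "p_union T p \<delta> t \<le> 1" using p by (simp add: p_union_def prod_nonneg)
qed

lemma estimation_error_probability:
  fixes n T L :: nat and w :: "real \<Rightarrow> nat \<Rightarrow> real" and p :: "real \<Rightarrow> real" and M t \<delta> \<mu> \<rho> \<beta> :: real
  defines "\<mu> \<equiv> M * \<delta> / T" and "\<beta> \<equiv> b_ratio n w t"
    and "\<rho> \<equiv> sqrt (ln n / (L * (n * p_union T p \<delta> t) * p_sum T p \<delta> t))"
  assumes n: "3 \<le> n" and T: "1 \<le> T" and L: "1 \<le> L"
    and w: "positive_scores n w" and smooth: "smooth_scores n w M"
    and p_range: "\<forall>s\<in>grid T. 0 \<le> p s \<and> p s \<le> 1"
    and t: "0 \<le> t" "t \<le> 1" and \<delta>: "1 / 2 \<le> \<delta>"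
    and psum: "120 * ln n \<le> p_sum T p \<delta> t"
    and small: "8 * \<beta> * (14 * \<rho> + \<mu>) \<le> 1 / 2" and n\<mu>: "n * \<mu> \<le> 1"
  shows "1 - 6 / real n ^ 9 \<le> measure_pmf.prob (dynamic_btl n T L w p)
    {(E, Y). pi_hat_defined n T L (3 * real n * p_union T p \<delta> t) \<delta> t E Y \<and>
       sup_norm n (\<lambda>i. pi_hat n T L (3 * real n * p_union T p \<delta> t) \<delta> t E Y i - pi_star n w t i) / sup_norm n (pi_star n w t)
       \<le> 6 * \<beta> * (10000 * gamma_factor n (n * p_union T p \<delta> t) \<beta> * \<rho> + 50 * (M * real n * \<delta> * \<beta> powr (7/2) / real T))}"
    (is "_ \<le> measure_pmf.prob _ ?good")
proof -
  let ?P = "p_sum T p \<delta> t" and ?pu = "p_union T p \<delta> t"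
  note p = p_range[rule_format]
  have q: "1 \<le> ln n"
  proof -
    have "exp 1 \<le> (3 :: real)" by (rule exp_le)
    then have "exp 1 \<le> real n" using n by linarith
    then show ?thesis using n by (simp add: ln_ge_iff)
  qed
  have P1: "1 \<le> ?P" using q psum by linarith
  note pu = p_union_bounds[OF p P1]
  \<comment> \<open>This is the scale of \<open>noise_tail\<close> for \<nu> = P / 2, the comparison
    count that most graphs guarantee.\<close>
  define \<epsilon> where "\<epsilon> = 1 / sqrt (L * ?P)"
  have LP: "1 \<le> L * ?P" using mult_mono[of 1 "real L" 1 ?P] L P1 by simp
  have \<epsilon>: "0 < \<epsilon>" "\<epsilon> \<le> 1" "\<epsilon>\<^sup>2 = 1 / (L * ?P)" using LP by (simp_all add: \<epsilon>_def power_divide)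
  have \<epsilon>2: "2 * real L * (?P / 2) * \<epsilon>\<^sup>2 = 1" using LP L P1 by (simp add: \<epsilon>(3))
  have \<rho>: "0 \<le> \<rho>" unfolding \<rho>_def using q pu P1 by simp
  have \<epsilon>\<rho>: "sqrt (n * ln n) * \<epsilon> \<le> n * \<rho>"
  proof (rule power2_le_imp_le)
    have "(sqrt (n * ln n) * \<epsilon>)\<^sup>2 = n * ln n / (L * ?P)" using q by (simp add: power_mult_distrib \<epsilon>(3))
    also have "\<dots> \<le> n * ln n / (L * ?P * ?pu)"
      using q pu LP L P1 by (intro divide_left_mono mult_pos_pos) (auto simp: mult_le_cancel_left2)
    also have "\<dots> = (n * \<rho>)\<^sup>2"
      using q pu P1 L n by (simp add: \<rho>_def power_mult_distrib power2_eq_square field_simps)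
    finally show "(sqrt (n * ln n) * \<epsilon>)\<^sup>2 \<le> (n * \<rho>)\<^sup>2" .
  qed (use \<rho> in simp)
  have d: "real n \<le> 3 * real n * ?pu" using pu(1) n by simp
  have \<mu>: "0 \<le> \<mu>" using smooth \<delta> by (simp add: \<mu>_def smooth_scores_def)
  have \<beta>: "1 \<le> \<beta>" unfolding \<beta>_def using n by (intro b_ratio_ge_1[OF w _ t]) auto
  define a where "a = (\<lambda>i. w t i / Max (w t ` {1..n}))"
  have a: "\<bar>a i\<bar> \<le> 1" if "i \<in> {1..n}" for i
  proof -
    have "w t i \<le> Max (w t ` {1..n})" using that by (intro Max_ge) auto
    moreover have "0 < w t i" using w t that by (simp add: positive_scores_def)
    ultimately show ?thesis by (simp add: a_def)
  qed
  define G where "G = - {E. \<exists>i\<in>{1..n}. \<exists>j\<in>{i<..n}. card (nbhd_edge T E \<delta> t i j) \<le> ?P / 2}"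
  define ok where "ok E = {Y. (\<forall>x z. \<bar>bilin {1..n} (noise T L w \<delta> t E Y) x z\<bar>
               \<le> 14 * sqrt n * \<epsilon> * L2_set x {1..n} * L2_set z {1..n})
      \<and> (\<forall>i\<in>{1..n}. \<bar>\<Sum>j\<in>{1..n}. noise T L w \<delta> t E Y i j\<bar> \<le> sqrt (10 * real n * ln n) * \<epsilon>)
      \<and> (\<forall>i\<in>{1..n}. \<bar>\<Sum>j\<in>{1..n}. noise T L w \<delta> t E Y i j * a j\<bar> \<le> sqrt (10 * real n * ln n) * \<epsilon>)}" for E
  have N: "?P / 2 \<le> card (nbhd_edge T E \<delta> t i j)" if "E \<in> G" "i \<in> {1..n}" "j \<in> {i<..n}" for E i j
    using that by (force simp: G_def)
  have good: "(E, Y) \<in> ?good" if E: "E \<in> G" and Y: "Y \<in> ok E" for E Y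
  proof -
    have N0: "0 < card (nbhd_edge T E \<delta> t i j)" if "i \<in> {1..n}" "j \<in> {i<..n}" for i j
      using N[OF E that] P1 by (cases "card (nbhd_edge T E \<delta> t i j)") auto
    have op: "\<And>x z. \<bar>bilin {1..n} (noise T L w \<delta> t E Y) x z\<bar>
               \<le> 14 * sqrt n * \<epsilon> * L2_set x {1..n} * L2_set z {1..n}"
      and r1: "\<And>i. i \<in> {1..n} \<Longrightarrow> \<bar>\<Sum>j\<in>{1..n}. noise T L w \<delta> t E Y i j\<bar> \<le> sqrt (10 * real n * ln n) * \<epsilon>"
      and r2: "\<And>i. i \<in> {1..n} \<Longrightarrow> \<bar>\<Sum>j\<in>{1..n}. noise T L w \<delta> t E Y i j * a j\<bar> \<le> sqrt (10 * real n * ln n) * \<epsilon>"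
      using Y unfolding ok_def by blast+
    note err = estimation_error[OF q T L w smooth t \<delta> N0 d \<epsilon>(1) op r1 r2[unfolded a_def] \<epsilon>\<rho> small[unfolded \<beta>_def \<mu>_def]]
    have "16 * \<beta> * (14 * \<rho> + \<mu>) + 128 * \<beta>\<^sup>2 * (14 * sqrt n * \<epsilon> + n * \<mu>)\<^sup>2 / (n * sqrt n)
      \<le> 6 * \<beta> * (10000 * gamma_factor n (n * ?pu) \<beta> * \<rho> + 50 * (M * real n * \<delta> * \<beta> powr (7/2) / real T))"
    proof -
      have "n * \<mu> * \<beta> powr (7/2) = M * real n * \<delta> * \<beta> powr (7/2) / real T" by (simp add: \<mu>_def)
      then show ?thesis
        using error_bound_simplify[OF \<beta> _ q \<rho> \<mu> \<epsilon>(1,2) \<epsilon>\<rho> n\<mu>, of "ln n / sqrt (n * ?pu)"] n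
        by (simp only: gamma_factor_def)
    qed
    with err show ?thesis unfolding \<mu>_def \<beta>_def by (auto intro: order_trans)
  qed
  have e9: "exp (- 9 * ln n) = 1 / real n ^ 9"
  proof -
    have "exp (- 9 * ln n) = inverse (exp (real 9 * ln n))" by (simp add: exp_minus)
    also have "exp (real 9 * ln n) = real n ^ 9" unfolding exp_of_nat_mult using n by simp
    finally show ?thesis by (simp add: inverse_eq_divide)
  qed
  have n_exp: "real n = exp (ln n)" using n by simp
  have probG: "1 - 1 / real n ^ 9 \<le> measure_pmf.prob (random_graphs n T p) G"
  proof -
    \<comment> \<open>The constant 120 makes a single edge count fail with probability at most
      n^(-12); n^2 pairs leave n^(-10).\<close>
    have "(real n)\<^sup>2 * exp (- ?P / 10) \<le> exp (2 * ln n) * exp (- 12 * ln n)"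
    proof (intro mult_mono)
      show "(real n)\<^sup>2 \<le> exp (2 * ln n)" using n by (simp add: exp_double)
    qed (use psum in auto)
    also have "\<dots> \<le> exp (- 9 * ln n)" using q by (simp add: exp_add[symmetric])
    finally have "(real n)\<^sup>2 * exp (- ?P / 10) \<le> 1 / real n ^ 9" unfolding e9 .
    moreover have "measure_pmf.prob (random_graphs n T p) (- G) \<le> (real n)\<^sup>2 * exp (- ?P / 10)"
      unfolding G_def double_complement by (rule edge_counts_tail) (rule p)
    ultimately have "measure_pmf.prob (random_graphs n T p) (- G) \<le> 1 / real n ^ 9" by linarith
    then show ?thesis using measure_pmf.prob_compl[of G "random_graphs n T p"] by (simp add: Compl_eq_Diff_UNIV)
  qed
  have probY: "1 - 5 / real n ^ 9 \<le> measure_pmf.prob (map_pmf (Pair E) (random_outcomes n T L w E)) ?good"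
    if E: "E \<in> G" for E
  proof -
    let ?M = "random_outcomes n T L w E"
    let ?B1 = "{Y. \<not> (\<forall>x z. \<bar>bilin {1..n} (noise T L w \<delta> t E Y) x z\<bar>
             \<le> 14 * sqrt n * \<epsilon> * L2_set x {1..n} * L2_set z {1..n})}"
    let ?B2 = "\<lambda>z. {Y. \<exists>i\<in>{1..n}. sqrt (10 * real n * ln n) * \<epsilon> < \<bar>\<Sum>j\<in>{1..n}. noise T L w \<delta> t E Y i j * z j\<bar>}"
    have n2: "2 \<le> n" and \<nu>: "0 < ?P / 2" using n P1 by auto
    have b1: "measure_pmf.prob ?M ?B1 \<le> 1 / real n ^ 9"
    proof -
      have "measure_pmf.prob ?M ?B1 \<le> exp (- 13 * real n)"
        by (rule noise_operator_concentration[OF n2 w L \<nu> N[OF E] \<epsilon>2 \<epsilon>(1)])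
      also have "\<dots> \<le> exp (- 9 * ln n)" using ln_le_minus_one[of "real n"] n by simp
      finally show ?thesis unfolding e9 .
    qed
    have b2: "measure_pmf.prob ?M (?B2 z) \<le> 2 / real n ^ 9" if "\<And>i. i \<in> {1..n} \<Longrightarrow> \<bar>z i\<bar> \<le> 1" for z
    proof -
      have "measure_pmf.prob ?M (?B2 z) \<le> 2 * real n * exp (- 10 * ln n)"
        by (rule noise_row_concentration[OF n2 w L \<nu> N[OF E] \<epsilon>2 \<epsilon>(1) that])
      also have "\<dots> = 2 * exp (- 9 * ln n)" by (subst (1) n_exp) (simp add: exp_add[symmetric] del: exp_ln)
      finally show ?thesis unfolding e9 by simp
    qed
    have "measure_pmf.prob ?M (- ok E) \<le> measure_pmf.prob ?M (?B1 \<union> (?B2 (\<lambda>_. 1) \<union> ?B2 a))"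
      by (intro measure_pmf.finite_measure_mono) (auto simp: ok_def not_le)
    also have "\<dots> \<le> measure_pmf.prob ?M ?B1 + (measure_pmf.prob ?M (?B2 (\<lambda>_. 1)) + measure_pmf.prob ?M (?B2 a))"
      by (intro order_trans[OF measure_Un_le] add_left_mono measure_Un_le) auto
    \<comment> \<open>One unit for the operator norm and two for each row bound; with the unit from
      the graphs the total is 6.\<close>
    also have "\<dots> \<le> 1 / real n ^ 9 + (2 / real n ^ 9 + 2 / real n ^ 9)"
      by (intro add_mono b1 b2 a) auto
    finally have "measure_pmf.prob ?M (- ok E) \<le> 5 / real n ^ 9" by simp
    then have "1 - 5 / real n ^ 9 \<le> measure_pmf.prob ?M (ok E)"
      using measure_pmf.prob_compl[of "ok E" ?M] by (simp add: Compl_eq_Diff_UNIV)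
    also have "\<dots> \<le> measure_pmf.prob ?M (Pair E -` ?good)"
      using good[OF E] by (intro measure_pmf.finite_measure_mono) auto
    finally show ?thesis by (simp add: measure_map_pmf)
  qed
  have "1 - (1 / real n ^ 9 + 5 / real n ^ 9) \<le> measure_pmf.prob (dynamic_btl n T L w p) ?good"
    unfolding dynamic_btl_def by (rule prob_bind_ge[OF probG _ probY]) auto
  then show ?thesis by simp
qed

theorem theorem3:
  shows "\<exists>c1 c0 c2 C1 C3 C4 C5 C6 K :: real.
    0 < c1 \<and> 1 \<le> c0 \<and> 1 \<le> c2 \<and> 15 \<le> C1 \<and> 1 \<le> C3 \<and> 1 \<le> C4 \<and> 1 \<le> C5 \<and> 1 \<le> C6 \<and> 0 < K \<and>
    (\<forall>(n::nat) (T::nat) (L::nat) (w :: real \<Rightarrow> nat \<Rightarrow> real) (M::real) (p :: real \<Rightarrow> real)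
      (t::real) (\<delta>::real).
      let np = real n * p_union T p \<delta> t;
          psum = p_sum T p \<delta> t;
          d = 3 * real n * p_union T p \<delta> t;
          \<beta> = b_ratio n w t;
          \<beta>max = b_max n T w \<delta> t;
          \<rho> = sqrt (ln (real n) / (real L * np * psum))
      in
        2 \<le> n \<and> 1 \<le> T \<and> 1 \<le> L \<and>
        positive_scores n w \<and> smooth_scores n w M \<and>
        (\<forall>s\<in>grid T. 0 \<le> p s \<and> p s \<le> 1) \<and>
        0 \<le> t \<and> t \<le> 1 \<and> 1/2 \<le> \<delta> \<and> \<delta> \<le> real T \<and>
        real n \<ge> c1 * ln (real n) \<and>
        np \<ge> c0 * ln (real n) \<and>
        psum \<ge> c2 * ln (real n) \<and>
        2 * C1 * \<rho> + 16 * (M * \<delta> * real n / real T) \<le> 1 / (96 * \<beta> powr (7/2)) \<and>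
        96 * \<beta> powr (5/2) * (4 * M * \<delta> / real T + C3 * sqrt (ln (real n) / np)) \<le> 1/2
        \<longrightarrow>
        measure_pmf.prob (dynamic_btl n T L w p)
          {(E, Y). pi_hat_defined n T L d \<delta> t E Y \<and>
             sup_norm n (\<lambda>i. pi_hat n T L d \<delta> t E Y i - pi_star n w t i) / sup_norm n (pi_star n w t)
               \<le> 12 * \<beta>max / (1 - C4 * \<beta>max * sqrt (ln (real n) / np))
                   * (C5 * gamma_factor n np \<beta> * \<rho>
                      + C6 * (M * real n * \<delta> * \<beta> powr (7/2) / real T))}
        \<ge> 1 - K / real n ^ 9)"
proof -
  have main: "1 - 512 / real n ^ 9 \<le> measure_pmf.prob (dynamic_btl n T L w p)
      {(E, Y). pi_hat_defined n T L (3 * real n * p_union T p \<delta> t) \<delta> t E Y \<and>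
         sup_norm n (\<lambda>i. pi_hat n T L (3 * real n * p_union T p \<delta> t) \<delta> t E Y i - pi_star n w t i) / sup_norm n (pi_star n w t)
           \<le> 12 * b_max n T w \<delta> t / (1 - 1 * b_max n T w \<delta> t * sqrt (ln (real n) / (real n * p_union T p \<delta> t)))
               * (10000 * gamma_factor n (real n * p_union T p \<delta> t) (b_ratio n w t)
                    * sqrt (ln (real n) / (real L * (real n * p_union T p \<delta> t) * p_sum T p \<delta> t))
                  + 50 * (M * real n * \<delta> * b_ratio n w t powr (7/2) / real T))}"
    if n2: "2 \<le> n" and T: "1 \<le> T" and L: "1 \<le> L" and w: "positive_scores n w" and smooth: "smooth_scores n w M"
      and p: "\<forall>s\<in>grid T. 0 \<le> p s \<and> p s \<le> 1" and t: "0 \<le> t" "t \<le> 1" and \<delta>: "1 / 2 \<le> \<delta>"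
      and np: "1 * ln (real n) \<le> real n * p_union T p \<delta> t"
      and psum: "120 * ln (real n) \<le> p_sum T p \<delta> t"
      and small: "2 * 15 * sqrt (ln (real n) / (real L * (real n * p_union T p \<delta> t) * p_sum T p \<delta> t))
          + 16 * (M * \<delta> * real n / real T) \<le> 1 / (96 * b_ratio n w t powr (7/2))"
      and small': "96 * b_ratio n w t powr (5/2) * (4 * M * \<delta> / real T
          + 1 * sqrt (ln (real n) / (real n * p_union T p \<delta> t))) \<le> 1/2"
    for n T L :: nat and w :: "real \<Rightarrow> nat \<Rightarrow> real" and M :: real and p :: "real \<Rightarrow> real" and t \<delta> :: real
  proof (cases "n = 2")
    \<comment> \<open>Since log 2 < 1, the case n = 2 is split off; 512 = 2^9 makes its bound
      0.\<close>
    case True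
    then show ?thesis by simp
  next
    case False
    then have n: "3 \<le> n" using n2 by simp
    let ?np = "real n * p_union T p \<delta> t"
    define \<beta> where "\<beta> = b_ratio n w t"
    define \<mu> where "\<mu> = M * \<delta> / T"
    define \<rho> where "\<rho> = sqrt (ln (real n) / (real L * ?np * p_sum T p \<delta> t))"
    define \<eta> where "\<eta> = sqrt (ln (real n) / ?np)"
    define bm where "bm = b_max n T w \<delta> t"
    define Q where "Q = 10000 * gamma_factor n ?np \<beta> * \<rho> + 50 * (M * real n * \<delta> * \<beta> powr (7/2) / real T)"
    have \<beta>: "1 \<le> \<beta>" unfolding \<beta>_def using n by (intro b_ratio_ge_1[OF w _ t]) auto
    have \<mu>: "0 \<le> \<mu>" using smooth \<delta> by (simp add: \<mu>_def smooth_scores_def)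
    have ln_n: "0 \<le> ln (real n)" using n by simp
    have \<rho>: "0 \<le> \<rho>" unfolding \<rho>_def using ln_n np psum by simp
    have \<eta>: "0 \<le> \<eta>" unfolding \<eta>_def using ln_n np by simp
    have pw: "\<beta> \<le> \<beta> powr (7/2)" "\<beta> \<le> \<beta> powr (5/2)"
      using powr_mono[of 1 "7/2" \<beta>] powr_mono[of 1 "5/2" \<beta>] \<beta> by simp_all
    have "30 * \<rho> + 16 * (n * \<mu>) \<le> 1 / (96 * \<beta> powr (7/2))"
      using small by (simp add: \<rho>_def \<mu>_def \<beta>_def mult.commute)
    also have "\<dots> \<le> 1 / (96 * \<beta>)" using pw \<beta> by (intro divide_left_mono) auto
    finally have s1: "30 * \<rho> + 16 * (n * \<mu>) \<le> 1 / (96 * \<beta>)" .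
    have n\<mu>_ge: "\<mu> \<le> n * \<mu>" using n \<mu> by (simp add: mult_le_cancel_right1)
    have "1 / (96 * \<beta>) \<le> 1 / 96" using \<beta> by simp
    then have n\<mu>: "n * \<mu> \<le> 1" using s1 \<rho> by linarith
    have s2: "8 * \<beta> * (14 * \<rho> + \<mu>) \<le> 1 / 2"
    proof -
      have "14 * \<rho> + \<mu> \<le> 1 / (96 * \<beta>)" using s1 \<rho> \<mu> n\<mu>_ge by linarith
      from mult_left_mono[OF this, of "8 * \<beta>"] show ?thesis using \<beta> by simp
    qed
    have s3: "\<mu> * (1 + \<beta>) \<le> 1 / 100"
    proof -
      have "16 * \<mu> \<le> 1 / (96 * \<beta>)" using s1 \<rho> \<mu> n\<mu>_ge by linarith
      from mult_left_mono[OF this, of \<beta>] have "\<beta> * \<mu> \<le> 1 / 1536" using \<beta> by simp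
      moreover have "\<mu> \<le> \<beta> * \<mu>" using \<mu> \<beta> by (simp add: mult_le_cancel_right1)
      ultimately show ?thesis by (simp add: algebra_simps)
    qed
    have bm: "\<beta> / 2 \<le> bm" "bm \<le> 2 * \<beta>"
      using b_max_bounds[OF w _ smooth T t \<delta>] s3 n by (simp_all add: \<beta>_def bm_def \<mu>_def)
    \<comment> \<open>The second smallness condition serves the denominator: the maximal ratio times
      \<eta> is at most 2 / 192, so the denominator lies in (0, 1].\<close>
    have "96 * \<beta> * \<eta> \<le> 96 * \<beta> powr (5/2) * (4 * \<mu> + \<eta>)"
      using pw \<beta> \<eta> \<mu> by (intro mult_mono) auto
    also have "\<dots> \<le> 1 / 2" using small' by (simp add: \<eta>_def \<mu>_def \<beta>_def mult.assoc)
    finally have "\<beta> * \<eta> \<le> 1 / 192" by simp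
    moreover have "bm * \<eta> \<le> 2 * \<beta> * \<eta>" using bm \<eta> by (intro mult_right_mono) auto
    moreover have bm\<eta>: "0 \<le> bm * \<eta>" using bm \<beta> \<eta> by simp
    ultimately have den: "0 < 1 - bm * \<eta>" "1 - bm * \<eta> \<le> 1" by linarith+
    have "0 \<le> gamma_factor n ?np \<beta>" unfolding gamma_factor_def using ln_n np \<beta>
      by (intro add_nonneg_nonneg mult_nonneg_nonneg divide_nonneg_nonneg) (auto simp: le_max_iff_disj)
    moreover have "0 \<le> M" using smooth by (simp add: smooth_scores_def)
    ultimately have Q: "0 \<le> Q" unfolding Q_def using \<rho> \<delta> by (intro add_nonneg_nonneg mult_nonneg_nonneg divide_nonneg_nonneg) auto
    \<comment> \<open>The factor 12 is 6 doubled, from \<beta> \<le> 2 \<open>bm\<close>; dividing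
      by a denominator at most 1 only enlarges the bound.\<close>
    have "6 * \<beta> \<le> 12 * bm / 1" using bm by simp
    also have "\<dots> \<le> 12 * bm / (1 - bm * \<eta>)" using bm \<beta> den by (intro divide_left_mono) auto
    finally have le: "6 * \<beta> * Q \<le> 12 * bm / (1 - bm * \<eta>) * Q" using Q by (rule mult_right_mono)
    have "1 - 512 / real n ^ 9 \<le> 1 - 6 / real n ^ 9" by (simp add: divide_right_mono)
    also note estimation_error_probability[OF n T L w smooth p t \<delta> psum
        s2[unfolded \<beta>_def \<rho>_def \<mu>_def] n\<mu>[unfolded \<mu>_def]]
    finally show ?thesis
    proof (rule order_trans, intro measure_pmf.finite_measure_mono)
      show "{(E, Y). pi_hat_defined n T L (3 * real n * p_union T p \<delta> t) \<delta> t E Y \<and>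
           sup_norm n (\<lambda>i. pi_hat n T L (3 * real n * p_union T p \<delta> t) \<delta> t E Y i - pi_star n w t i) / sup_norm n (pi_star n w t)
           \<le> 6 * b_ratio n w t * (10000 * gamma_factor n ?np (b_ratio n w t)
                * sqrt (ln (real n) / (real L * ?np * p_sum T p \<delta> t))
              + 50 * (M * real n * \<delta> * b_ratio n w t powr (7/2) / real T))}
        \<subseteq> {(E, Y). pi_hat_defined n T L (3 * real n * p_union T p \<delta> t) \<delta> t E Y \<and>
           sup_norm n (\<lambda>i. pi_hat n T L (3 * real n * p_union T p \<delta> t) \<delta> t E Y i - pi_star n w t i) / sup_norm n (pi_star n w t)
           \<le> 12 * b_max n T w \<delta> t / (1 - 1 * b_max n T w \<delta> t * sqrt (ln (real n) / ?np))
               * (10000 * gamma_factor n ?np (b_ratio n w t)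
                    * sqrt (ln (real n) / (real L * ?np * p_sum T p \<delta> t))
                  + 50 * (M * real n * \<delta> * b_ratio n w t powr (7/2) / real T))}"
        using order_trans[OF _ le] unfolding Q_def \<beta>_def \<rho>_def \<eta>_def bm_def mult_1 by blast
    qed simp
  qed
  \<comment> \<open>The witness 120 comes from the edge counts, 10000 and 50 from
    \<open>error_bound_simplify\<close>, 512 from n = 2; the others are the least values allowed, or
    1 for c1.\<close>
  show ?thesis
    unfolding Let_def
    by (rule exI[of _ 1], rule exI[of _ 1], rule exI[of _ 120], rule exI[of _ 15], rule exI[of _ 1],
        rule exI[of _ 1], rule exI[of _ 10000], rule exI[of _ 50], rule exI[of _ 512],
        intro conjI allI impI) ((elim conjE, rule main; assumption) | simp)+
qed

end
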